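(* Let $\bar x_0\in X$. Suppose that there is $M>0$ with $$0\le f(x)-\ell_f(x;y)\le M\|x-y\|\qquad\text{for all }x,y\in X,$$ and that there is $\mu^*>0$ with $f(x)-f^*\ge \frac{\mu^*}{2}\operatorname{dist}^2(x,X^* )$ for all $x\in\{z\in X: f(z)\le f(\bar x_0)\}$. Let $m\ge 1$ be an integer, let $\mu_0\ge\mu^*$, and let $(\bar x_k,\mu_k,\Delta_k)_{k\ge0}$ be generated by $\mathrm{BLW}(\bar x_0,\mu_0,m)$. For any $\epsilon>0$ define $$S_\epsilon:=\max\left\{0,\left\lceil\log_{4/3}\left(\frac{4\mu_0\Delta_0}{\mu^*\epsilon}\right)\right\rceil\right\}\le\max\left\{0,\left\lceil\log_{4/3}\left(\frac{8\|f'(\bar x_0)\|^2}{\mu^*\epsilon}\right)\right\rceil\right\}.$$ Then $$f(\bar x_{S_\epsilon})-f^*\le\epsilon .$$ The center sequence is Fejér monotone with respect to $X^*$: $$\operatorname{dist}(\bar x_k,X^* )\le\operatorname{dist}(\bar x_{k-1},X^* ),\qquad k\ge1.$$ Moreover, the number $N_\epsilon$ of first-order oracle evaluations used up to the construction of $\bar x_{S_\epsilon}$ satisfies $$N_\epsilon\le\frac{3500M^2}{\mu^*\epsilon}+6S_\epsilon+2\log_2\left(\frac{4\mu_0}{\mu^*}\right)+1.$$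
   Context: Setting. $X\subseteq\mathbb{R}^d$ is a closed convex set (Euclidean inner product $\langle\cdot,\cdot\rangle$ and norm $\|\cdot\|$), $f:X\to\mathbb{R}$ is closed convex, $f^*=\min_{x\in X}f(x)$, and $X^*=\arg\min_{x\in X}f(x)$ is assumed nonempty; $\operatorname{dist}$ is Euclidean distance. A first-order oracle queried at $y\in X$ returns $f(y)$ and a subgradient $f'(y)\in\partial f(y)$ (so $f(x)\ge f(y)+\langle f'(y),x-y\rangle$ for $x\in X$); $\ell_f(x;y):=f(y)+\langle f'(y),x-y\rangle$. Notation: $[t]_+=\max\{t,0\}$, $a\vee b=\max\{a,b\}$. An affine minorant of $f$ is an affine function $h$ with $h\le f$ on $X$. Procedure $\mathrm{BLCI}(\bar x,\mu,\Delta,m,a^{(0)})$. Inputs: evaluation center $\bar x\in X$, modulus estimate $\mu$, gap estimate $\Delta$, memory length $m\ge1$, affine minorant $a^{(0)}$ of $f$. Output: a triple (affine minorant, point, flag True/False). Set $\ell=f(\bar x)-\Delta$. (1) If $\{x\in X:a^{(0)}(x)\le\ell\}=\emptyset$, return $(a^{(0)},\bar x,\text{True})$. (2) Let $x_0\in\arg\min_{x\in X}\{\|\bar x-x\|^2:a^{(0)}(x)\le\ell\}$ and query the oracle at $x_0$. (3) For $t=1,2,\dots$: (a) let $\psi_t(x):=a^{(t-1)}(x)\vee\max_{[t-m]_+\le i\le t-1}\ell_f(x;x_i)$ and $c_t:=\inf_{x\in X}\psi_t(x)$; if $c_t\ge\ell$, return (constant function $c_t$, $\bar x$, True). (b) Let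 $x_t$ be the minimizer of $\|\bar x-x\|^2$ over $x\in X$ subject to $a^{(t-1)}(x)\le\ell$ and $\ell_f(x;x_i)\le\ell$ for $[t-m]_+\le i\le t-1$. (c) Take optimal Lagrange (KKT) multipliers of these inequality constraints, normalize them to $\lambda_a,\lambda_i\ge0$ with $\lambda_a+\sum_i\lambda_i=1$, and set $a^{(t)}:=\lambda_aa^{(t-1)}+\sum_{i=[t-m]_+}^{t-1}\lambda_i\ell_f(\cdot;x_i)$. (d) If $\|\bar x-x_t\|^2/\Delta^2\ge2/(\mu\Delta)$, return $(a^{(t)},\bar x,\text{True})$. (e) Query the oracle at $x_t$; if $f(x_t)<f(\bar x)-4\Delta/5$, return $(a^{(t)},x_t,\text{False})$. Procedure $\mathrm{BLW}(\bar x_0,\mu_0,m)$. Query the oracle at $\bar x_0$ and set $\Delta_0:=2\|f'(\bar x_0)\|^2/\mu_0$. For $k=1,2,\dots$: set $\hat\mu_k:=\mu_{k-1}$, $\hat\Delta_k:=\frac34\Delta_{k-1}$. (i) Run $(a_{k,1},y_{k,1},\mathrm{flag})\leftarrow\mathrm{BLCI}(\bar x_{k-1},\hat\mu_k,\hat\Delta_k,m,\ell_f(\cdot;\bar x_{k-1}))$. If the flag is True, set $(\bar x_k,\mu_k,\Delta_k):=(\bar x_{k-1},\hat\mu_k,\hat\Delta_k)$ and go to outer iteration $k+1$. (ii) Otherwise run $(a_{k,2},z_k,\mathrm{flag})\leftarrow\mathrm{BLCI}(\bar x_{k-1},\hat\mu_k,4\hat\Delta_k/5,m,a_{k,1})$.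 If the flag is True, set $(\bar x_k,\mu_k,\Delta_k):=(\bar x_{k-1},\hat\mu_k,\hat\Delta_k)$ and go to $k+1$. (iii) Otherwise set $\bar x_k:=z_k$, $\mu_{k,0}:=\hat\mu_k$, $\Delta_{k,0}:=\hat\Delta_k$, $a^{[k]}_0:=\ell_f(\cdot;\bar x_k)$, and for $r=1,2,\dots$ run $(a^{[k]}_r,x_{k,r},\mathrm{flag})\leftarrow\mathrm{BLCI}(\bar x_k,\mu_{k,r-1},\Delta_{k,r-1},m,a^{[k]}_{r-1})$; if the flag is True, set $\mu_k:=\mu_{k,r-1}$, $\Delta_k:=\Delta_{k,r-1}$ and go to $k+1$; otherwise discard $x_{k,r}$, set $\mu_{k,r}:=\mu_{k,r-1}/2$, $\Delta_{k,r}:=2\Delta_{k,r-1}$ and continue with $r+1$. Oracle evaluations are counted at every "query" above. *)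

theory Defs
  imports "HOL-Analysis.Analysis"
begin

definition minimizers :: "'a set \<Rightarrow> ('a \<Rightarrow> real) \<Rightarrow> 'a set" where
  "minimizers X f = {x. is_arg_min f (\<lambda>x. x \<in> X) x}"

definition subdifferential :: "'a::real_inner set \<Rightarrow> ('a \<Rightarrow> real) \<Rightarrow> 'a \<Rightarrow> 'a set" where
  "subdifferential X f y = {g. \<forall>x\<in>X. f x \<ge> f y + g \<bullet> (x - y)}"

text \<open>
  The state of a call of BLCI. \<open>Iter a xs\<close> is the state at the beginning of the pass of the loop
  with \<open>t = length xs\<close> (so \<open>t \<ge> 1\<close>): the points queried so far are
  \<open>x\<^sub>i = xs ! i\<close> for \<open>i < t\<close>, and \<open>a\<close> is the aggregate minorant with index \<open>t - 1\<close>.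
\<close>

datatype 'a blci_state =
    Entry
  | Iter "'a \<Rightarrow> real" "'a list"
  | Return "'a \<Rightarrow> real" 'a bool

text \<open>
  The state of BLW. \<open>Outer k x \<mu> \<Delta>\<close>: outer iteration \<open>k\<close> is complete and
  \<open>(x, \<mu>, \<Delta>)\<close> is the triple it has produced (\<open>k = 0\<close>: the initial triple).
  The states \<open>StepI k\<close>, \<open>StepII k\<close>, \<open>StepIII k\<close>
  belong to the three parts of outer iteration \<open>k\<close>. They carry the current center, the current
  estimates \<open>\<mu>\<close> and \<open>\<Delta>\<close>, the minorant passed to the running call of BLCI (omitted in
  \<open>StepI\<close>, where it is the linearization at the center), and the state of that call.
\<close>

datatype 'a blw_state =
    Outer nat 'a real real
  | StepI nat 'a real real "'a blci_state"
  | StepII nat 'a real real "'a \<Rightarrow> real" "'a blci_state"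
  | StepIII nat 'a real real "'a \<Rightarrow> real" "'a blci_state"

context
  fixes X :: "'a::euclidean_space set"
    and f :: "'a \<Rightarrow> real"
    and f' :: "'a \<Rightarrow> 'a"
begin

definition lin :: "'a \<Rightarrow> 'a \<Rightarrow> real" where
  "lin y x = f y + f' y \<bullet> (x - y)"

text \<open>The indices of the remembered cuts; subtraction on \<open>nat\<close> truncates at zero.\<close>

definition window :: "nat \<Rightarrow> 'a list \<Rightarrow> nat set" where
  "window m xs = {length xs - m..<length xs}"

definition bundle_model :: "nat \<Rightarrow> ('a \<Rightarrow> real) \<Rightarrow> 'a list \<Rightarrow> 'a \<Rightarrow> real" where
  "bundle_model m a xs z = max (a z) (MAX i\<in>window m xs. lin (xs ! i) z)"

text \<open>An extended real, since the model may be unbounded below on \<open>X\<close>.\<close>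

definition lower_bound :: "nat \<Rightarrow> ('a \<Rightarrow> real) \<Rightarrow> 'a list \<Rightarrow> ereal" where
  "lower_bound m a xs = (INF z\<in>X. ereal (bundle_model m a xs z))"

definition level_set :: "nat \<Rightarrow> real \<Rightarrow> ('a \<Rightarrow> real) \<Rightarrow> 'a list \<Rightarrow> 'a set" where
  "level_set m l a xs = {z \<in> X. a z \<le> l \<and> (\<forall>i\<in>window m xs. lin (xs ! i) z \<le> l)}"

text \<open>
  Multipliers for the functional constraints only; the constraint \<open>z \<in> X\<close> is kept in the
  minimization of the Lagrangian.
\<close>

definition kkt_multipliers ::
    "nat \<Rightarrow> 'a \<Rightarrow> real \<Rightarrow> ('a \<Rightarrow> real) \<Rightarrow> 'a list \<Rightarrow> 'a \<Rightarrow> real \<Rightarrow> (nat \<Rightarrow> real) \<Rightarrow> bool" where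
  "kkt_multipliers m xbar l a xs y \<Lambda>a \<Lambda> \<longleftrightarrow>
     y \<in> level_set m l a xs \<and>
     \<Lambda>a \<ge> 0 \<and> (\<forall>i\<in>window m xs. \<Lambda> i \<ge> 0) \<and>
     \<Lambda>a * (a y - l) = 0 \<and> (\<forall>i\<in>window m xs. \<Lambda> i * (lin (xs ! i) y - l) = 0) \<and>
     is_arg_min (\<lambda>z. (norm (xbar - z))\<^sup>2 + \<Lambda>a * (a z - l)
                     + (\<Sum>i\<in>window m xs. \<Lambda> i * (lin (xs ! i) z - l))) (\<lambda>z. z \<in> X) y"

definition aggregate ::
    "nat \<Rightarrow> 'a \<Rightarrow> real \<Rightarrow> ('a \<Rightarrow> real) \<Rightarrow> 'a list \<Rightarrow> 'a \<Rightarrow> ('a \<Rightarrow> real) \<Rightarrow> bool" where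
  "aggregate m xbar l a xs y a' \<longleftrightarrow>
     (\<exists>\<Lambda>a \<Lambda>. kkt_multipliers m xbar l a xs y \<Lambda>a \<Lambda> \<and>
        (let s = \<Lambda>a + (\<Sum>i\<in>window m xs. \<Lambda> i) in
           s > 0 \<and>
           a' = (\<lambda>z. (\<Lambda>a / s) * a z + (\<Sum>i\<in>window m xs. (\<Lambda> i / s) * lin (xs ! i) z))))"

text \<open>Parts (a)--(c) of a pass of the loop in which part (a) does not return.\<close>

definition pass ::
    "nat \<Rightarrow> 'a \<Rightarrow> real \<Rightarrow> ('a \<Rightarrow> real) \<Rightarrow> 'a list \<Rightarrow> 'a \<Rightarrow> ('a \<Rightarrow> real) \<Rightarrow> bool" where
  "pass m xbar l a xs y a' \<longleftrightarrow>
     lower_bound m a xs < ereal l \<and>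
     is_arg_min (\<lambda>z. (norm (xbar - z))\<^sup>2) (\<lambda>z. z \<in> level_set m l a xs) y \<and>
     aggregate m xbar l a xs y a'"

text \<open>
  \<open>blci_step xbar \<mu> \<Delta> m a0 s q s'\<close>: in the call \<open>BLCI(xbar, \<mu>, \<Delta>, m, a0)\<close>, state \<open>s\<close> can be
  followed by state \<open>s'\<close>, and this transition makes \<open>q\<close> oracle queries. It is a relation since the
  multipliers need not be unique.
\<close>

inductive blci_step ::
    "'a \<Rightarrow> real \<Rightarrow> real \<Rightarrow> nat \<Rightarrow> ('a \<Rightarrow> real) \<Rightarrow> 'a blci_state \<Rightarrow> nat \<Rightarrow> 'a blci_state \<Rightarrow> bool"
  for xbar :: 'a and \<mu> \<Delta> :: real and m :: nat and a0 :: "'a \<Rightarrow> real"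
where
  empty_level:
    "{x \<in> X. a0 x \<le> f xbar - \<Delta>} = {} \<Longrightarrow>
     blci_step xbar \<mu> \<Delta> m a0 Entry 0 (Return a0 xbar True)"
| start:
    "is_arg_min (\<lambda>x. (norm (xbar - x))\<^sup>2) (\<lambda>x. x \<in> X \<and> a0 x \<le> f xbar - \<Delta>) x0 \<Longrightarrow>
     blci_step xbar \<mu> \<Delta> m a0 Entry 1 (Iter a0 [x0])"
| lower_bound_reached:
    "lower_bound m a xs \<ge> ereal (f xbar - \<Delta>) \<Longrightarrow>
     blci_step xbar \<mu> \<Delta> m a0 (Iter a xs) 0
       (Return (\<lambda>_. real_of_ereal (lower_bound m a xs)) xbar True)"
| far_away:
    "pass m xbar (f xbar - \<Delta>) a xs y a' \<Longrightarrow>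
     (norm (xbar - y))\<^sup>2 / \<Delta>\<^sup>2 \<ge> 2 / (\<mu> * \<Delta>) \<Longrightarrow>
     blci_step xbar \<mu> \<Delta> m a0 (Iter a xs) 0 (Return a' xbar True)"
| descent:
    "pass m xbar (f xbar - \<Delta>) a xs y a' \<Longrightarrow>
     (norm (xbar - y))\<^sup>2 / \<Delta>\<^sup>2 < 2 / (\<mu> * \<Delta>) \<Longrightarrow>
     f y < f xbar - 4 * \<Delta> / 5 \<Longrightarrow>
     blci_step xbar \<mu> \<Delta> m a0 (Iter a xs) 1 (Return a' y False)"
| continue:
    "pass m xbar (f xbar - \<Delta>) a xs y a' \<Longrightarrow>
     (norm (xbar - y))\<^sup>2 / \<Delta>\<^sup>2 < 2 / (\<mu> * \<Delta>) \<Longrightarrow>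
     f y \<ge> f xbar - 4 * \<Delta> / 5 \<Longrightarrow>
     blci_step xbar \<mu> \<Delta> m a0 (Iter a xs) 1 (Iter a' (xs @ [y]))"

inductive blw_step :: "nat \<Rightarrow> 'a blw_state \<Rightarrow> nat \<Rightarrow> 'a blw_state \<Rightarrow> bool"
  for m :: nat
where
  next_outer:
    "blw_step m (Outer k x \<mu> \<Delta>) 0 (StepI (Suc k) x \<mu> (3 / 4 * \<Delta>) Entry)"
| run_I:
    "blci_step x \<mu> \<Delta> m (lin x) s q s' \<Longrightarrow>
     blw_step m (StepI k x \<mu> \<Delta> s) q (StepI k x \<mu> \<Delta> s')"
| true_I:
    "blw_step m (StepI k x \<mu> \<Delta> (Return a y True)) 0 (Outer k x \<mu> \<Delta>)"
| false_I:
    "blw_step m (StepI k x \<mu> \<Delta> (Return a y False)) 0 (StepII k x \<mu> \<Delta> a Entry)"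
| run_II:
    "blci_step x \<mu> (4 * \<Delta> / 5) m a s q s' \<Longrightarrow>
     blw_step m (StepII k x \<mu> \<Delta> a s) q (StepII k x \<mu> \<Delta> a s')"
| true_II:
    "blw_step m (StepII k x \<mu> \<Delta> a (Return a' z True)) 0 (Outer k x \<mu> \<Delta>)"
| false_II:
    "blw_step m (StepII k x \<mu> \<Delta> a (Return a' z False)) 0 (StepIII k z \<mu> \<Delta> (lin z) Entry)"
| run_III:
    "blci_step x \<mu> \<Delta> m a s q s' \<Longrightarrow>
     blw_step m (StepIII k x \<mu> \<Delta> a s) q (StepIII k x \<mu> \<Delta> a s')"
| true_III:
    "blw_step m (StepIII k x \<mu> \<Delta> a (Return a' y True)) 0 (Outer k x \<mu> \<Delta>)"
| false_III:
    "blw_step m (StepIII k x \<mu> \<Delta> a (Return a' y False)) 0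
       (StepIII k x (\<mu> / 2) (2 * \<Delta>) a' Entry)"

text \<open>
  \<open>\<sigma> 0, \<dots>, \<sigma> L\<close> is an initial segment of an execution of \<open>BLW(x0, \<mu>0, m)\<close>,
  and \<open>N n\<close> counts the oracle queries made up to state \<open>\<sigma> n\<close>, including the initial one
  at \<open>x0\<close>. The index \<open>k\<close> never decreases along an execution and is increased exactly when a state
  \<open>Outer k x \<mu> \<Delta>\<close> is left, so there is at most one such state for each \<open>k\<close>.
\<close>

definition blw_prefix ::
    "'a \<Rightarrow> real \<Rightarrow> nat \<Rightarrow> nat \<Rightarrow> (nat \<Rightarrow> 'a blw_state) \<Rightarrow> (nat \<Rightarrow> nat) \<Rightarrow> bool" where
  "blw_prefix x0 \<mu>0 m L \<sigma> N \<longleftrightarrow>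
     \<sigma> 0 = Outer 0 x0 \<mu>0 (2 * (norm (f' x0))\<^sup>2 / \<mu>0) \<and> N 0 = 1 \<and>
     (\<forall>n<L. \<exists>q. blw_step m (\<sigma> n) q (\<sigma> (Suc n)) \<and> N (Suc n) = N n + q)"

text \<open>BLW has no stopping rule, so its complete executions are infinite.\<close>

definition blw_run ::
    "'a \<Rightarrow> real \<Rightarrow> nat \<Rightarrow> (nat \<Rightarrow> 'a blw_state) \<Rightarrow> (nat \<Rightarrow> nat) \<Rightarrow> bool" where
  "blw_run x0 \<mu>0 m \<sigma> N \<longleftrightarrow> (\<forall>L. blw_prefix x0 \<mu>0 m L \<sigma> N)"

end

end

theory Submission
  imports Defs
begin

text \<open>
  Write \<open>G x = f x - f\<^sup>*\<close>. Doubling \<open>\<Delta>\<close> and halving \<open>\<mu>\<close> together preserves \<open>\<mu> \<Delta>\<close>, so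
  \<open>\<mu>\<^sub>k \<Delta>\<^sub>k = (3 / 4)\<^sup>k \<mu>\<^sub>0 \<Delta>\<^sub>0\<close> exactly. Accuracy follows from two facts. First, a call of BLCI that
  returns True proves \<open>G x \<le> max 1 (\<mu> / \<mu>\<^sup>*) \<Delta>\<close>: either a minorant of \<open>f\<close> stays above the level
  \<open>f x - \<Delta>\<close>, or the sublevel set is far from \<open>x\<close>, and then quadratic growth limits the gap
  (\<open>gap_le_of_far_level\<close>). Second, \<open>\<mu>\<^sub>k \<ge> 3 / 10 \<mu>\<^sup>*\<close>. Indeed a halving is caused by a point that
  shows \<open>G x > 4 / 5 \<Delta>\<close> at a center chosen in step (ii), and for such a center
  \<open>G x \<le> max (52 / 75 \<Delta>) (4 / 3 \<mu> \<Delta> / \<mu>\<^sup>*)\<close> (\<open>new_center_gap\<close>). Therefore \<open>\<mu> > 3 / 5 \<mu>\<^sup>*\<close>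
  before the halving.

  The queries are paid for by distance. An aggregate built from multipliers has the current point as
  projection of the center (\<open>pass_project\<close>), so each step adds at least its square to the squared
  distance from the center. A pass that continues has moved by at least \<open>\<Delta> / (5 M)\<close>, and the distance test
  stops the call at the squared distance \<open>2 \<Delta> / \<mu>\<close>; at most \<open>50 M\<^sup>2 / (\<mu> \<Delta>)\<close> passes
  continue. In step (iii) the aggregate is passed on, and doubling \<open>\<Delta>\<close> at least doubles the distance that it guarantees
  (\<open>travel_double_gap\<close>). All calls of step (iii) therefore share one such allowance, and each halving
  costs just two queries more. Summation over \<open>k\<close> is geometric (\<open>query_budget\<close>).

  Fejer monotonicity holds because a new center is a projection onto a convex set that contains all
  minimizers (\<open>center_step\<close>). A run cannot get stuck: the projections exist, a point where the model is
  below the level is a Slater point, and the multipliers that it provides do not all vanish,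
  since the center is cut off (\<open>pass_exists\<close>).

  Counting and termination are handled by one invariant, \<open>run_inv\<close>, in which a step with \<open>q\<close> queries
  costs \<open>q + c\<close>. With \<open>c = 0\<close> it bounds the number of queries. With \<open>c = 1\<close> it bounds the number of steps
  up to each outer iteration, so every outer iteration ends.
\<close>

section \<open>Lagrange multipliers and projections\<close>

text \<open>
  A multiplier separates the slopes \<open>(v - \<phi> z) / g z\<close> of the infeasible points from those of the
  strictly feasible ones: the segment between one of each contains a point with \<open>g \<le> 0\<close>, where
  \<open>\<phi> \<ge> v\<close> by assumption. Hence the supremum of the former slopes and 0 will do; the Slater point
  makes it finite.
\<close>

lemma lagrange_multiplier_single:
  fixes \<phi> g :: "'v::real_vector \<Rightarrow> real"
  assumes \<phi>: "convex_on C \<phi>" and g: "convex_on C g"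
    and slater: "z0 \<in> C" "g z0 < 0"
    and bound: "\<And>z. z \<in> C \<Longrightarrow> g z \<le> 0 \<Longrightarrow> v \<le> \<phi> z"
  shows "\<exists>\<Lambda>\<ge>0. \<forall>z\<in>C. v \<le> \<phi> z + \<Lambda> * g z"
proof -
  let ?slope = "\<lambda>z. (v - \<phi> z) / g z"
  define T where "T = insert 0 (?slope ` {z\<in>C. 0 < g z})"
  have le: "t \<le> (\<phi> z - v) / (- g z)" if t: "t \<in> T" and z: "z \<in> C" "g z < 0" for t z
  proof -
    have *: "v \<le> \<phi> z" using bound z by simp
    show ?thesis
    proof (cases "t = 0")
      case True
      then show ?thesis using * z by (simp add: divide_simps)
    next
      case False
      then obtain w where w: "w \<in> C" "0 < g w" "t = ?slope w" using t unfolding T_def by auto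
      define \<theta> where "\<theta> = g w / (g w - g z)"
      have d: "g w - g z > 0" using w z by simp
      have \<theta>: "0 \<le> \<theta>" "\<theta> \<le> 1" using w z d by (auto simp: \<theta>_def divide_simps)
      let ?p = "(1 - \<theta>) *\<^sub>R w + \<theta> *\<^sub>R z"
      have pC: "?p \<in> C" using convex_on_imp_convex[OF g] w z \<theta> by (simp add: convexD)
      \<comment> \<open>\<open>\<theta>\<close> makes the chord of \<open>g\<close> from \<open>w\<close> to \<open>z\<close> vanish at \<open>?p\<close>.\<close>
      have "g ?p \<le> (1 - \<theta>) * g w + \<theta> * g z" using convex_onD[OF g \<theta> w(1) z(1)] .
      also have "\<dots> = 0" using d by (simp add: \<theta>_def field_simps)
      finally have "v \<le> \<phi> ?p" using bound pC by simp
      also have "\<dots> \<le> (1 - \<theta>) * \<phi> w + \<theta> * \<phi> z" using convex_onD[OF \<phi> \<theta> w(1) z(1)] .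
      finally have "v * (g w - g z) \<le> ((1 - \<theta>) * \<phi> w + \<theta> * \<phi> z) * (g w - g z)"
        using d by (simp add: mult_right_mono)
      also have "\<dots> = - g z * \<phi> w + g w * \<phi> z"
      proof -
        have "\<theta> * (g w - g z) = g w" "(1 - \<theta>) * (g w - g z) = - g z"
          using d by (auto simp: \<theta>_def field_simps)
        then show ?thesis by (metis (no_types, lifting) distrib_right mult.assoc mult.commute)
      qed
      finally have "(v - \<phi> w) * (- g z) \<le> (\<phi> z - v) * g w"
        by (simp add: algebra_simps)
      then have "v - \<phi> w \<le> (\<phi> z - v) * g w / (- g z)"
        using pos_le_divide_eq[of "- g z" "v - \<phi> w" "(\<phi> z - v) * g w"] z by linarith
      then show ?thesis
        using pos_divide_le_eq[OF w(2), of "v - \<phi> w" "(\<phi> z - v) / (- g z)"]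
        unfolding w(3) times_divide_eq_left by blast
    qed
  qed
  have bdd: "bdd_above T" using le slater by (meson bdd_aboveI)
  have T0: "0 \<in> T" by (simp add: T_def)
  define \<Lambda> where "\<Lambda> = Sup T"
  have "0 \<le> \<Lambda>" unfolding \<Lambda>_def using cSup_upper[OF T0 bdd] .
  moreover have "v \<le> \<phi> z + \<Lambda> * g z" if z: "z \<in> C" for z
  proof -
    consider "g z < 0" | "g z = 0" | "g z > 0" by linarith
    then show ?thesis
    proof cases
      case 1
      then have "\<Lambda> \<le> (\<phi> z - v) / (- g z)"
        unfolding \<Lambda>_def using T0 le z by (intro cSup_least) auto
      then show ?thesis using 1 by (simp add: divide_simps algebra_simps)
    next
      case 2
      then show ?thesis using bound z by simp
    next
      case 3
      then have "?slope z \<le> \<Lambda>"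
        unfolding \<Lambda>_def using z by (intro cSup_upper bdd) (auto simp: T_def)
      then show ?thesis using 3 by (simp add: divide_simps algebra_simps)
    qed
  qed
  ultimately show ?thesis by blast
qed

text \<open>
  Constraints are dualized one at a time, the remaining ones being kept in the domain. The
  hypothesis bounds the values by a number \<open>v\<close> and names no minimizer, so that it survives the
  replacement of \<open>\<phi>\<close> by \<open>\<phi> + \<Lambda> g\<close>.
\<close>

lemma lagrange_multipliers:
  fixes \<phi> :: "'v::real_vector \<Rightarrow> real" and g :: "'i \<Rightarrow> 'v \<Rightarrow> real"
  assumes "finite I" "convex_on C \<phi>" "\<And>i. i \<in> I \<Longrightarrow> convex_on C (g i)"
    and "z0 \<in> C" "\<And>i. i \<in> I \<Longrightarrow> g i z0 < 0"
    and "\<And>z. z \<in> C \<Longrightarrow> (\<And>i. i \<in> I \<Longrightarrow> g i z \<le> 0) \<Longrightarrow> v \<le> \<phi> z"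
  shows "\<exists>\<Lambda>. (\<forall>i\<in>I. 0 \<le> \<Lambda> i) \<and> (\<forall>z\<in>C. v \<le> \<phi> z + (\<Sum>i\<in>I. \<Lambda> i * g i z))"
  using assms
proof (induction I arbitrary: \<phi> rule: finite_induct)
  case empty
  then show ?case by auto
next
  case (insert j I)
  define C' where "C' = {z\<in>C. \<forall>i\<in>I. g i z \<le> 0}"
  have cC: "convex C" using insert.prems(1) convex_on_imp_convex by blast
  have C': "convex C'"
  proof (rule convexI)
    fix x y :: 'v and a b :: real
    assume xy: "x \<in> C'" "y \<in> C'" and ab: "0 \<le> a" "0 \<le> b" "a + b = 1"
    have "g i (a *\<^sub>R x + b *\<^sub>R y) \<le> 0" if i: "i \<in> I" for i
    proof -
      have "g i (a *\<^sub>R x + b *\<^sub>R y) \<le> a * g i x + b * g i y"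
        using insert.prems(2)[of i] i xy ab unfolding convex_on_def C'_def by auto
      also have "\<dots> \<le> 0"
        using xy ab i by (auto simp: C'_def intro!: add_nonpos_nonpos mult_nonneg_nonpos)
      finally show ?thesis .
    qed
    then show "a *\<^sub>R x + b *\<^sub>R y \<in> C'" using xy ab cC by (auto simp: C'_def convexD)
  qed
  have sub: "C' \<subseteq> C" by (auto simp: C'_def)
  obtain \<Lambda>j where \<Lambda>j: "\<Lambda>j \<ge> 0" "\<forall>z\<in>C'. v \<le> \<phi> z + \<Lambda>j * g j z"
  proof -
    have "convex_on C' \<phi>" "convex_on C' (g j)"
      using insert.prems convex_on_subset[OF _ sub C'] by auto
    moreover have "z0 \<in> C'" "g j z0 < 0"
      using insert.prems by (auto simp: C'_def less_imp_le)
    moreover have "v \<le> \<phi> z" if "z \<in> C'" "g j z \<le> 0" for z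
      using that insert.prems(5)[of z] by (auto simp: C'_def)
    ultimately show thesis using lagrange_multiplier_single[of C' \<phi> "g j" z0 v] that by blast
  qed
  let ?\<phi> = "\<lambda>z. \<phi> z + \<Lambda>j * g j z"
  have "convex_on C ?\<phi>"
    using insert.prems \<Lambda>j by (intro convex_on_add convex_on_cmul) auto
  then obtain \<Lambda> where \<Lambda>: "\<forall>i\<in>I. 0 \<le> \<Lambda> i" "\<forall>z\<in>C. v \<le> ?\<phi> z + (\<Sum>i\<in>I. \<Lambda> i * g i z)"
    using insert.IH[of ?\<phi>] insert.prems \<Lambda>j(2) unfolding C'_def by auto
  have sum: "(\<Sum>i\<in>I. (\<Lambda>(j := \<Lambda>j)) i * g i z) = (\<Sum>i\<in>I. \<Lambda> i * g i z)" for z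
    using insert.hyps by (intro sum.cong) auto
  show ?case
    by (rule exI[of _ "\<Lambda>(j := \<Lambda>j)"])
       (use \<Lambda> \<Lambda>j insert.hyps sum in \<open>auto simp: add.assoc\<close>)
qed

lemma convex_on_norm_diff_power2:
  fixes c :: "'v::real_inner"
  assumes "convex C"
  shows "convex_on C (\<lambda>z. (norm (c - z))\<^sup>2)"
proof (rule convex_onI[OF _ assms])
  fix t :: real and x y :: 'v
  assume t: "0 < t" "t < 1"
  have "(1 - t) * (norm (c - x))\<^sup>2 + t * (norm (c - y))\<^sup>2
        - (norm (c - ((1 - t) *\<^sub>R x + t *\<^sub>R y)))\<^sup>2 = t * (1 - t) * (norm (x - y))\<^sup>2"
    unfolding power2_norm_eq_inner
    by (simp add: inner_diff_left inner_diff_right inner_add_left inner_add_right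
        inner_commute algebra_simps)
  moreover have "0 \<le> t * (1 - t) * (norm (x - y))\<^sup>2" using t by simp
  ultimately show "(norm (c - ((1 - t) *\<^sub>R x + t *\<^sub>R y)))\<^sup>2
      \<le> (1 - t) * (norm (c - x))\<^sup>2 + t * (norm (c - y))\<^sup>2" by linarith
qed

lemma closest_point_obtuse:
  fixes C :: "'v::euclidean_space set"
  assumes C: "convex C" "closed C" and y: "y \<in> C" "\<And>z. z \<in> C \<Longrightarrow> norm (x - y) \<le> norm (x - z)"
    and z: "z \<in> C"
  shows "(norm (x - y))\<^sup>2 + (norm (z - y))\<^sup>2 \<le> (norm (x - z))\<^sup>2"
proof -
  have "(x - y) \<bullet> (z - y) \<le> 0"
    using any_closest_point_dot[OF C y(1) z] y(2) by (simp add: dist_norm)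
  moreover have "(norm (x - z))\<^sup>2 = (norm (x - y))\<^sup>2 + (norm (z - y))\<^sup>2 - 2 * ((x - y) \<bullet> (z - y))"
    unfolding power2_norm_eq_inner
    by (simp add: inner_diff_left inner_diff_right inner_commute algebra_simps)
  ultimately show ?thesis by linarith
qed

lemma convex_on_finite_sum:
  fixes g :: "'i \<Rightarrow> 'v::real_vector \<Rightarrow> real"
  assumes "convex C" "\<And>i. i \<in> I \<Longrightarrow> convex_on C (g i)"
  shows "convex_on C (\<lambda>z. \<Sum>i\<in>I. g i z)"
  using assms
proof (induction I rule: infinite_finite_induct)
  case (insert i I)
  then have "convex_on C (\<lambda>z. g i z + (\<Sum>i\<in>I. g i z))" by (intro convex_on_add) auto
  then show ?case using insert by simp
qed (auto simp: convex_on_const)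

section \<open>A pass of the level method\<close>

lemma finite_window [simp]: "finite (window m xs)"
  by (simp add: window_def)

lemma nth_window: "i \<in> window m xs \<Longrightarrow> xs ! i \<in> set xs"
  by (simp add: window_def)

lemma last_in_window: "m \<ge> 1 \<Longrightarrow> xs \<noteq> [] \<Longrightarrow> length xs - 1 \<in> window m xs"
  by (cases xs) (auto simp: window_def)

locale convex_oracle =
  fixes X :: "'a::euclidean_space set" and f :: "'a \<Rightarrow> real" and f' :: "'a \<Rightarrow> 'a"
  assumes closed_X: "closed X" and convex_X: "convex X"
    and convex_f: "convex_on X f"
    and lin_le: "\<And>x y. x \<in> X \<Longrightarrow> y \<in> X \<Longrightarrow> lin f f' y x \<le> f x"
begin

text \<open>
  Closure under nonnegative combinations and closed convex sublevel sets within \<open>X\<close> are what the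
  analysis takes from affine functions; convexity and continuity on \<open>X\<close> provide both.
\<close>

definition minorant :: "('a \<Rightarrow> real) \<Rightarrow> bool" where
  "minorant a \<longleftrightarrow> convex_on X a \<and> continuous_on X a \<and> (\<forall>z\<in>X. a z \<le> f z)"

definition level_projection :: "'a \<Rightarrow> ('a \<Rightarrow> real) \<Rightarrow> real \<Rightarrow> 'a \<Rightarrow> bool" where
  "level_projection x a l y \<longleftrightarrow>
     y \<in> X \<and> a y \<le> l \<and> (\<forall>z\<in>X. a z \<le> l \<longrightarrow> norm (x - y) \<le> norm (x - z))"

lemma minorant_lin: "y \<in> X \<Longrightarrow> minorant (lin f f' y)"
proof -
  assume y: "y \<in> X"
  have "convex_on X (lin f f' y)"
    unfolding convex_on_def lin_def
  proof (intro conjI ballI allI impI convex_X)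
    fix p q :: 'a and u v :: real
    assume uv: "0 \<le> u" "0 \<le> v" "u + v = 1"
    have "f y = u * f y + v * f y" "f' y \<bullet> y = u * (f' y \<bullet> y) + v * (f' y \<bullet> y)"
      using uv(3) by (metis distrib_right mult_1)+
    then show "f y + f' y \<bullet> (u *\<^sub>R p + v *\<^sub>R q - y)
        \<le> u * (f y + f' y \<bullet> (p - y)) + v * (f y + f' y \<bullet> (q - y))"
      by (simp add: inner_diff_right inner_add_right algebra_simps)
  qed
  moreover have "continuous_on X (lin f f' y)"
    unfolding lin_def by (intro continuous_intros)
  ultimately show ?thesis using lin_le y by (simp add: minorant_def)
qed

lemma closed_convex_sublevel:
  assumes "minorant a"
  shows "closed {z\<in>X. a z \<le> l}" "convex {z\<in>X. a z \<le> l}"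
proof -
  have "closed (X \<inter> a -` {..l})"
    using assms closed_X by (intro continuous_closed_preimage) (auto simp: minorant_def)
  moreover have "X \<inter> a -` {..l} = {z\<in>X. a z \<le> l}" by auto
  ultimately show "closed {z\<in>X. a z \<le> l}" by simp
  show "convex {z\<in>X. a z \<le> l}"
  proof (rule convexI)
    fix x y :: 'a and u v :: real
    assume *: "x \<in> {z\<in>X. a z \<le> l}" "y \<in> {z\<in>X. a z \<le> l}" "0 \<le> u" "0 \<le> v" "u + v = 1"
    have "a (u *\<^sub>R x + v *\<^sub>R y) \<le> u * a x + v * a y"
      using assms * unfolding minorant_def convex_on_def by auto
    also have "\<dots> \<le> u * l + v * l" using * by (intro add_mono mult_left_mono) auto
    also have "\<dots> = l" using * by (metis distrib_right mult_1)
    finally show "u *\<^sub>R x + v *\<^sub>R y \<in> {z\<in>X. a z \<le> l}"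
      using * convex_X by (auto simp: convexD)
  qed
qed

lemma level_projection_obtuse:
  assumes "minorant a" "level_projection x a l y" "z \<in> X" "a z \<le> l"
  shows "(norm (x - y))\<^sup>2 + (norm (z - y))\<^sup>2 \<le> (norm (x - z))\<^sup>2"
  using assms closed_convex_sublevel[OF assms(1), of l]
  by (intro closest_point_obtuse[of "{z\<in>X. a z \<le> l}"]) (auto simp: level_projection_def)

text \<open>
  Either the level set cuts off the center, or the projection is the center itself. In the second
  case the next linearization, taken at the center, cuts it off.
\<close>

lemma level_projection_center:
  assumes "level_projection x a l y" "x \<in> X" "a x \<le> l"
  shows "y = x"
  using assms unfolding level_projection_def by force

text \<open>
  Complementarity makes the aggregate \<open>a'\<close> equal to the level at \<open>y\<close>, so minimality of \<open>y\<close> for the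
  Lagrangian says that \<open>y\<close> is still the projection of the center when all cuts are replaced by the
  single minorant \<open>a'\<close>. This is why discarding old cuts loses none of the distance gained.
\<close>

lemma pass_project:
  assumes a: "minorant a" and xs: "set xs \<subseteq> X" and "pass X f f' m x l a xs y a'"
  shows "minorant a'" "level_projection x a' l y" "y \<in> level_set X f f' m l a xs"
proof -
  let ?W = "window m xs"
  obtain \<Lambda>a \<Lambda> where kkt: "kkt_multipliers X f f' m x l a xs y \<Lambda>a \<Lambda>"
    and s0: "\<Lambda>a + (\<Sum>i\<in>?W. \<Lambda> i) > 0"
    and a': "a' = (\<lambda>z. (\<Lambda>a / (\<Lambda>a + (\<Sum>i\<in>?W. \<Lambda> i))) * a z
       + (\<Sum>i\<in>?W. (\<Lambda> i / (\<Lambda>a + (\<Sum>i\<in>?W. \<Lambda> i))) * lin f f' (xs ! i) z))"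
    using assms(3) unfolding pass_def aggregate_def by (auto simp: Let_def)
  define s where "s = \<Lambda>a + (\<Sum>i\<in>?W. \<Lambda> i)"
  have s: "s > 0" using s0 by (simp add: s_def)
  have nn: "\<Lambda>a \<ge> 0" "\<And>i. i \<in> ?W \<Longrightarrow> \<Lambda> i \<ge> 0"
    and lev: "y \<in> level_set X f f' m l a xs"
    using kkt by (auto simp: kkt_multipliers_def)
  have mi: "minorant (lin f f' (xs ! i))" if "i \<in> ?W" for i
    using nth_window[OF that] xs by (intro minorant_lin) auto
  have s_a': "s * (a' z - l) = \<Lambda>a * (a z - l) + (\<Sum>i\<in>?W. \<Lambda> i * (lin f f' (xs ! i) z - l))" for z
  proof -
    have "s * a' z = \<Lambda>a * a z + (\<Sum>i\<in>?W. \<Lambda> i * lin f f' (xs ! i) z)"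
      using s unfolding a' s_def[symmetric] by (simp add: distrib_left sum_distrib_left)
    moreover have "s * l = \<Lambda>a * l + (\<Sum>i\<in>?W. \<Lambda> i * l)"
      by (simp add: s_def distrib_right sum_distrib_right)
    ultimately show ?thesis by (simp add: right_diff_distrib sum_subtractf)
  qed
  have min: "(norm (x - y))\<^sup>2 + s * (a' y - l) \<le> (norm (x - z))\<^sup>2 + s * (a' z - l)"
    if "z \<in> X" for z
    using kkt that unfolding kkt_multipliers_def is_arg_min_linorder s_a' by (auto simp: add.assoc)
  have zero: "s * (a' y - l) = 0"
  proof -
    have "\<Lambda>a * (a y - l) = 0" "\<forall>i\<in>?W. \<Lambda> i * (lin f f' (xs ! i) y - l) = 0"
      using kkt unfolding kkt_multipliers_def by blast+
    then show ?thesis unfolding s_a' by (simp add: sum.neutral)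
  qed
  with s have a'y: "a' y = l" by simp
  have "norm (x - y) \<le> norm (x - z)" if "z \<in> X" "a' z \<le> l" for z
  proof (rule power2_le_imp_le)
    have "s * (a' z - l) \<le> 0" using s that by (simp add: mult_nonneg_nonpos)
    then show "(norm (x - y))\<^sup>2 \<le> (norm (x - z))\<^sup>2" using min[OF that(1)] zero by linarith
  qed simp
  then show "level_projection x a' l y"
    using a'y lev by (auto simp: level_projection_def level_set_def)
  show "y \<in> level_set X f f' m l a xs" by fact
  have "convex_on X a'"
    unfolding a' s_def[symmetric] using a mi nn s convex_X
    by (intro convex_on_add convex_on_cmul convex_on_finite_sum) (auto simp: minorant_def)
  moreover have "continuous_on X a'"
    unfolding a' using a mi by (intro continuous_intros) (auto simp: minorant_def)
  moreover have "a' z \<le> f z" if z: "z \<in> X" for z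
  proof -
    have "s * a' z = \<Lambda>a * a z + (\<Sum>i\<in>?W. \<Lambda> i * lin f f' (xs ! i) z)"
      using s unfolding a' s_def[symmetric] by (simp add: distrib_left sum_distrib_left)
    also have "\<dots> \<le> \<Lambda>a * f z + (\<Sum>i\<in>?W. \<Lambda> i * f z)"
      using a mi nn z by (intro add_mono sum_mono mult_left_mono) (auto simp: minorant_def)
    also have "\<dots> = s * f z" by (simp add: s_def distrib_right sum_distrib_right)
    finally show ?thesis using s by simp
  qed
  ultimately show "minorant a'" by (simp add: minorant_def)
qed

lemma bundle_model_less:
  assumes "m \<ge> 1" "xs \<noteq> []"
  shows "bundle_model f f' m a xs z < l \<longleftrightarrow>
         a z < l \<and> (\<forall>i\<in>window m xs. lin f f' (xs ! i) z < l)"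
  using last_in_window[OF assms] unfolding bundle_model_def
  by (subst max_less_iff_conj, subst Max_less_iff) auto

lemma bundle_model_le:
  assumes "m \<ge> 1" "xs \<noteq> []" "minorant a" "set xs \<subseteq> X" "z \<in> X"
  shows "bundle_model f f' m a xs z \<le> f z"
proof -
  have "\<forall>i\<in>window m xs. lin f f' (xs ! i) z \<le> f z"
    using assms nth_window by (meson lin_le subsetD)
  then have "(MAX i\<in>window m xs. lin f f' (xs ! i) z) \<le> f z"
    using last_in_window[OF assms(1,2)] by (subst Max_le_iff) auto
  moreover have "a z \<le> f z" using assms by (simp add: minorant_def)
  ultimately show ?thesis unfolding bundle_model_def by simp
qed

lemma lower_bound_le:
  assumes "m \<ge> 1" "xs \<noteq> []" "minorant a" "set xs \<subseteq> X" "ereal l \<le> lower_bound X f f' m a xs"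
    and "z \<in> X"
  shows "l \<le> f z"
proof -
  have "ereal l \<le> ereal (bundle_model f f' m a xs z)"
    using assms(5,6) unfolding lower_bound_def by (rule_tac order_trans[OF _ INF_lower])
  then show ?thesis using bundle_model_le[OF assms(1-4,6)] by simp
qed

text \<open>
  A pass can be carried out whenever it is entered: a lower bound below the level provides a Slater
  point for the cuts, which yields multipliers. They are not all zero, since otherwise \<open>y\<close> would be the
  unconstrained projection of \<open>x\<close>, that is \<open>x\<close> itself, which the cuts exclude.
\<close>

lemma pass_exists:
  assumes m: "m \<ge> 1" and xs: "xs \<noteq> []" "set xs \<subseteq> X" and a: "minorant a" and x: "x \<in> X"
    and lb: "lower_bound X f f' m a xs < ereal l"
    and out: "x \<notin> level_set X f f' m l a xs"
  shows "\<exists>y a'. pass X f f' m x l a xs y a'"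
proof -
  let ?W = "window m xs" and ?L = "level_set X f f' m l a xs"
  have mi: "minorant (lin f f' (xs ! i))" if "i \<in> ?W" for i
    using nth_window[OF that] xs by (intro minorant_lin) auto
  obtain z0 where z0: "z0 \<in> X" "bundle_model f f' m a xs z0 < l"
    using lb unfolding lower_bound_def by (auto simp: INF_less_iff)
  then have slater: "a z0 < l" "\<And>i. i \<in> ?W \<Longrightarrow> lin f f' (xs ! i) z0 < l"
    using bundle_model_less[OF m xs(1)] by auto
  have "z0 \<in> ?L" using slater z0 by (auto simp: level_set_def less_imp_le)
  moreover have "closed ?L"
  proof -
    have "?L = {z\<in>X. a z \<le> l} \<inter> (\<Inter>i\<in>?W. {z\<in>X. lin f f' (xs ! i) z \<le> l})"
      using last_in_window[OF m xs(1)] by (auto simp: level_set_def)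
    then show ?thesis
      using closed_convex_sublevel(1) a mi by (auto intro!: closed_Int closed_INT)
  qed
  ultimately obtain y where y: "y \<in> ?L" "\<And>z. z \<in> ?L \<Longrightarrow> dist x y \<le> dist x z"
    using distance_attains_inf[of ?L x] by blast
  \<comment> \<open>The index \<open>None\<close> stands for the constraint \<open>a \<le> l\<close>, \<open>Some i\<close> for the cut at \<open>xs ! i\<close>.\<close>
  define g where "g = (\<lambda>j z. case j of None \<Rightarrow> a z - l | Some i \<Rightarrow> lin f f' (xs ! i) z - l)"
  define I where "I = insert None (Some ` ?W)"
  have sumI: "(\<Sum>j\<in>I. h j) = h None + (\<Sum>i\<in>?W. h (Some i))" for h :: "nat option \<Rightarrow> real"
    unfolding I_def by (subst sum.insert) (auto simp: sum.reindex)
  have convex_shift: "convex_on X (\<lambda>z. h z - l)" if "minorant h" for h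
    using that convex_X convex_on_add[of X h "\<lambda>_. - l"] by (simp add: minorant_def convex_on_const)
  have "\<exists>\<Lambda>. (\<forall>j\<in>I. 0 \<le> \<Lambda> j) \<and>
      (\<forall>z\<in>X. (norm (x - y))\<^sup>2 \<le> (norm (x - z))\<^sup>2 + (\<Sum>j\<in>I. \<Lambda> j * g j z))"
  proof (rule lagrange_multipliers)
    show "finite I" by (simp add: I_def)
    show "convex_on X (\<lambda>z. (norm (x - z))\<^sup>2)" by (rule convex_on_norm_diff_power2[OF convex_X])
    show "convex_on X (g j)" if "j \<in> I" for j
      using that a mi convex_shift by (auto simp: I_def g_def)
    show "z0 \<in> X" by fact
    show "g j z0 < 0" if "j \<in> I" for j
      using that slater by (auto simp: I_def g_def)
    show "(norm (x - y))\<^sup>2 \<le> (norm (x - z))\<^sup>2"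
      if z: "z \<in> X" and *: "\<And>j. j \<in> I \<Longrightarrow> g j z \<le> 0" for z
    proof -
      have "a z \<le> l" using *[of None] by (simp add: I_def g_def)
      moreover have "lin f f' (xs ! i) z \<le> l" if "i \<in> ?W" for i
        using *[of "Some i"] that by (simp add: I_def g_def)
      ultimately have "z \<in> ?L" using z by (simp add: level_set_def)
      then show ?thesis using y(2) by (simp add: dist_norm power_mono)
    qed
  qed
  then obtain \<Lambda> where \<Lambda>: "\<And>j. j \<in> I \<Longrightarrow> 0 \<le> \<Lambda> j"
    "\<And>z. z \<in> X \<Longrightarrow> (norm (x - y))\<^sup>2 \<le> (norm (x - z))\<^sup>2 + (\<Sum>j\<in>I. \<Lambda> j * g j z)" by auto
  have yX: "y \<in> X" using y by (simp add: level_set_def)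
  have np: "\<Lambda> j * g j y \<le> 0" if "j \<in> I" for j
    using that y \<Lambda> by (auto simp: level_set_def I_def g_def intro!: mult_nonneg_nonpos)
  have zero: "\<Lambda> j * g j y = 0" if "j \<in> I" for j
  proof -
    have "0 \<le> (\<Sum>j\<in>I. \<Lambda> j * g j y)" using \<Lambda>(2)[OF yX] by simp
    then have "(\<Sum>j\<in>I. - (\<Lambda> j * g j y)) = 0"
      using sum_nonneg[of I "\<lambda>j. - (\<Lambda> j * g j y)"] np by (simp add: sum_negf)
    moreover have "finite I" by (simp add: I_def)
    ultimately have "\<forall>j\<in>I. - (\<Lambda> j * g j y) = 0"
      using np by (subst (asm) sum_nonneg_eq_0_iff) auto
    then show ?thesis using that by simp
  qed
  let ?\<Lambda>a = "\<Lambda> None" and ?\<Lambda> = "\<lambda>i. \<Lambda> (Some i)"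
  have kkt: "kkt_multipliers X f f' m x l a xs y ?\<Lambda>a ?\<Lambda>"
    unfolding kkt_multipliers_def is_arg_min_linorder
  proof (intro conjI ballI allI impI)
    show "y \<in> ?L" "y \<in> X" by fact+
    show "0 \<le> ?\<Lambda>a" using \<Lambda>(1) by (simp add: I_def)
    show "0 \<le> ?\<Lambda> i" if "i \<in> ?W" for i using \<Lambda>(1) that by (simp add: I_def)
    show za: "?\<Lambda>a * (a y - l) = 0" using zero[of None] by (simp add: I_def g_def)
    show zi: "?\<Lambda> i * (lin f f' (xs ! i) y - l) = 0" if "i \<in> ?W" for i
      using zero[of "Some i"] that by (simp add: I_def g_def)
    fix z assume z: "z \<in> X"
    have "(\<Sum>i\<in>?W. ?\<Lambda> i * (lin f f' (xs ! i) y - l)) = 0" using zi by (simp add: sum.neutral)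
    then show "(norm (x - y))\<^sup>2 + ?\<Lambda>a * (a y - l) + (\<Sum>i\<in>?W. ?\<Lambda> i * (lin f f' (xs ! i) y - l))
        \<le> (norm (x - z))\<^sup>2 + ?\<Lambda>a * (a z - l) + (\<Sum>i\<in>?W. ?\<Lambda> i * (lin f f' (xs ! i) z - l))"
      using \<Lambda>(2)[OF z] za unfolding sumI g_def option.case by linarith
  qed
  have pos: "?\<Lambda>a + (\<Sum>i\<in>?W. ?\<Lambda> i) > 0"
  proof (rule ccontr)
    assume "\<not> ?thesis"
    then have "(\<Sum>j\<in>I. \<Lambda> j) \<le> 0" by (simp add: sumI)
    then have "(\<Sum>j\<in>I. \<Lambda> j) = 0" using sum_nonneg[of I \<Lambda>] \<Lambda>(1) by force
    then have "\<forall>j\<in>I. \<Lambda> j = 0"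
      using sum_nonneg_eq_0_iff[of I \<Lambda>] \<Lambda>(1) by (simp add: I_def)
    then have "(norm (x - y))\<^sup>2 \<le> 0" using \<Lambda>(2)[OF x] by simp
    then show False using out y by simp
  qed
  have "aggregate X f f' m x l a xs y
     (\<lambda>z. (?\<Lambda>a / (?\<Lambda>a + (\<Sum>i\<in>?W. ?\<Lambda> i))) * a z
        + (\<Sum>i\<in>?W. (?\<Lambda> i / (?\<Lambda>a + (\<Sum>i\<in>?W. ?\<Lambda> i))) * lin f f' (xs ! i) z))"
    unfolding aggregate_def Let_def using kkt pos by blast
  moreover have "is_arg_min (\<lambda>z. (norm (x - z))\<^sup>2) (\<lambda>z. z \<in> ?L) y"
    using y by (auto simp: is_arg_min_linorder dist_norm power_mono)
  ultimately show ?thesis using lb unfolding pass_def by blast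
qed

end

section \<open>Gap certificates and travelled distance\<close>

locale blw_problem = convex_oracle X f f'
  for X :: "'a::euclidean_space set" and f :: "'a \<Rightarrow> real" and f' :: "'a \<Rightarrow> 'a" +
  fixes M \<mu>star fstar \<mu>0 :: real and Xstar :: "'a set" and xinit :: 'a and m :: nat
  assumes M_pos: "M > 0"
    and lin_error: "\<And>x y. x \<in> X \<Longrightarrow> y \<in> X \<Longrightarrow> f x - lin f f' y x \<le> M * norm (x - y)"
    and fstar_le: "\<And>x. x \<in> X \<Longrightarrow> fstar \<le> f x"
    and Xstar: "Xstar \<subseteq> X" "Xstar \<noteq> {}" "\<And>z. z \<in> Xstar \<Longrightarrow> f z = fstar"
    and xinit: "xinit \<in> X"
    and \<mu>star_pos: "\<mu>star > 0"
    and growth: "\<And>x. x \<in> X \<Longrightarrow> f x \<le> f xinit \<Longrightarrow> \<mu>star / 2 * (infdist x Xstar)\<^sup>2 \<le> f x - fstar"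
    and \<mu>0: "\<mu>star \<le> \<mu>0"
    and m: "m \<ge> 1"
begin

text \<open>
  If the gap \<open>G\<close> exceeds \<open>\<Delta>\<close>, then by convexity \<open>f\<close> has fallen to the level \<open>f x - \<Delta>\<close> at the fraction
  \<open>\<theta> = \<Delta> / G\<close> of each segment from \<open>x\<close> to a minimizer. So the distance to the sublevel set bounds
  the distance to the minimizers from below, and quadratic growth turns this into a bound on \<open>G\<close>.
\<close>

lemma gap_le_of_far_level:
  assumes x: "x \<in> X" "f x \<le> f xinit" and pos: "\<mu> > 0" "\<Delta> > 0"
    and far: "\<And>z. z \<in> X \<Longrightarrow> f z \<le> f x - \<Delta> \<Longrightarrow> 2 * \<Delta> / \<mu> \<le> (norm (x - z))\<^sup>2"
  shows "f x - fstar \<le> max 1 (\<mu> / \<mu>star) * \<Delta>"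
proof (cases "f x - fstar \<le> \<Delta>")
  case True
  also have "\<Delta> \<le> max 1 (\<mu> / \<mu>star) * \<Delta>" using pos by simp
  finally show ?thesis .
next
  case False
  define G where "G = f x - fstar"
  define \<theta> where "\<theta> = \<Delta> / G"
  have G: "G > \<Delta>" "G > 0" using False pos by (auto simp: G_def)
  have \<theta>: "0 < \<theta>" "\<theta> \<le> 1" using G pos by (auto simp: \<theta>_def)
  have "sqrt (2 * \<Delta> / \<mu>) / \<theta> \<le> infdist x Xstar"
    unfolding infdist_notempty[OF Xstar(2)]
  proof (rule cINF_greatest[OF Xstar(2)])
    fix z assume z: "z \<in> Xstar"
    let ?w = "(1 - \<theta>) *\<^sub>R x + \<theta> *\<^sub>R z"
    have zX: "z \<in> X" using z Xstar by auto
    have wX: "?w \<in> X" using convex_X x zX \<theta> by (simp add: convexD)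
    have "f ?w \<le> (1 - \<theta>) * f x + \<theta> * f z"
      using convex_onD[OF convex_f _ _ x(1) zX, of \<theta>] \<theta> by simp
    also have "\<dots> = f x - \<theta> * G" using Xstar(3)[OF z] by (simp add: G_def algebra_simps)
    also have "\<dots> = f x - \<Delta>" using G by (simp add: \<theta>_def)
    finally have "2 * \<Delta> / \<mu> \<le> (norm (x - ?w))\<^sup>2" using far wX by simp
    then have "sqrt (2 * \<Delta> / \<mu>) \<le> norm (x - ?w)" by (simp add: real_le_lsqrt)
    also have "x - ?w = \<theta> *\<^sub>R (x - z)" by (simp add: algebra_simps)
    also have "norm \<dots> = \<theta> * dist x z" using \<theta> by (simp add: dist_norm)
    finally show "sqrt (2 * \<Delta> / \<mu>) / \<theta> \<le> dist x z" using \<theta> by (simp add: field_simps)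
  qed
  then have "(sqrt (2 * \<Delta> / \<mu>) / \<theta>)\<^sup>2 \<le> (infdist x Xstar)\<^sup>2"
    using \<theta> pos by (intro power_mono) auto
  then have "\<mu>star / 2 * (sqrt (2 * \<Delta> / \<mu>) / \<theta>)\<^sup>2 \<le> \<mu>star / 2 * (infdist x Xstar)\<^sup>2"
    using \<mu>star_pos by simp
  also have "\<dots> \<le> G" unfolding G_def by (rule growth[OF x])
  also have "(sqrt (2 * \<Delta> / \<mu>) / \<theta>)\<^sup>2 = 2 * G\<^sup>2 / (\<mu> * \<Delta>)"
    using pos G by (simp add: power_divide \<theta>_def power2_eq_square field_simps)
  finally have "\<mu>star * G\<^sup>2 \<le> G * (\<mu> * \<Delta>)"
    using pos by (simp add: field_simps)
  then have "\<mu>star * G \<le> \<mu> * \<Delta>" using G by (simp add: power2_eq_square)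
  then have "G \<le> \<mu> / \<mu>star * \<Delta>" using \<mu>star_pos by (simp add: field_simps)
  also have "\<dots> \<le> max 1 (\<mu> / \<mu>star) * \<Delta>" using pos by (intro mult_right_mono) auto
  finally show ?thesis by (simp add: G_def)
qed

text \<open>
  For the gap \<open>G\<close>, the subgradient inequality gives \<open>G \<le> |f'| dist\<close> and growth gives \<open>dist\<^sup>2 \<le> 2 G / \<mu>\<^sup>*\<close>;
  eliminate the distance.
\<close>

lemma initial_gap: "f xinit - fstar \<le> 2 * (norm (f' xinit))\<^sup>2 / \<mu>star"
proof -
  define G where "G = f xinit - fstar"
  have G0: "G \<ge> 0" using fstar_le xinit by (simp add: G_def)
  have "G \<le> norm (f' xinit) * dist xinit z" if z: "z \<in> Xstar" for z
  proof -
    have "lin f f' xinit z \<le> fstar" using lin_le[of z xinit] Xstar z xinit by auto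
    then have "G \<le> f' xinit \<bullet> (xinit - z)" by (simp add: G_def lin_def inner_diff_right)
    also have "\<dots> \<le> norm (f' xinit) * norm (xinit - z)" by (rule norm_cauchy_schwarz)
    finally show ?thesis by (simp add: dist_norm)
  qed
  then have le: "G \<le> norm (f' xinit) * infdist xinit Xstar"
  proof (cases "f' xinit = 0")
    case False
    have "G / norm (f' xinit) \<le> infdist xinit Xstar"
      unfolding infdist_notempty[OF Xstar(2)]
      using \<open>\<And>z. z \<in> Xstar \<Longrightarrow> G \<le> norm (f' xinit) * dist xinit z\<close> False
      by (intro cINF_greatest[OF Xstar(2)]) (simp add: field_simps)
    then show ?thesis using False by (simp add: field_simps)
  qed (use Xstar in force)
  then have "G\<^sup>2 \<le> (norm (f' xinit) * infdist xinit Xstar)\<^sup>2" using G0 by (rule power_mono)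
  also have "\<dots> = (norm (f' xinit))\<^sup>2 * (infdist xinit Xstar)\<^sup>2" by (simp add: power_mult_distrib)
  also have "\<dots> \<le> (norm (f' xinit))\<^sup>2 * (2 * G / \<mu>star)"
  proof (rule mult_left_mono)
    show "(infdist xinit Xstar)\<^sup>2 \<le> 2 * G / \<mu>star"
      using growth[OF xinit] \<mu>star_pos by (simp add: G_def field_simps)
  qed simp
  finally have "G * G \<le> G * (2 * (norm (f' xinit))\<^sup>2 / \<mu>star)" by (simp add: power2_eq_square mult_ac)
  then have "G \<le> 2 * (norm (f' xinit))\<^sup>2 / \<mu>star" if "G \<noteq> 0"
    using that G0 mult_left_le_imp_le[of G G "2 * (norm (f' xinit))\<^sup>2 / \<mu>star"] by linarith
  moreover have "0 \<le> 2 * (norm (f' xinit))\<^sup>2 / \<mu>star" using \<mu>star_pos by simp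
  ultimately show ?thesis unfolding G_def[symmetric] by (cases "G = 0") auto
qed

text \<open>
  The squared distance from the center in units in which one continued pass of BLCI advances by at
  least 1. Division by \<open>\<Delta>\<^sup>2\<close> makes the quantity comparable between calls with different gap
  estimates.
\<close>

definition travel :: "'a \<Rightarrow> real \<Rightarrow> 'a \<Rightarrow> real" where
  "travel x \<Delta> y = 25 * M\<^sup>2 * (norm (x - y))\<^sup>2 / \<Delta>\<^sup>2"

text \<open>
  The threshold of the distance test of BLCI in the units of \<open>travel\<close>. It depends on \<open>\<mu>\<close> and \<open>\<Delta>\<close>
  only through their product, which step (iii) of BLW preserves.
\<close>

definition reach :: "real \<Rightarrow> real \<Rightarrow> real" where
  "reach \<mu> \<Delta> = 50 * M\<^sup>2 / (\<mu> * \<Delta>)"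

lemma travel_nonneg [simp]: "0 \<le> travel x \<Delta> y"
  by (simp add: travel_def)

lemma travel_less_reach:
  assumes "(norm (x - y))\<^sup>2 / \<Delta>\<^sup>2 < 2 / (\<mu> * \<Delta>)"
  shows "travel x \<Delta> y < reach \<mu> \<Delta>"
proof -
  have "25 * M\<^sup>2 * ((norm (x - y))\<^sup>2 / \<Delta>\<^sup>2) < 25 * M\<^sup>2 * (2 / (\<mu> * \<Delta>))"
    using M_pos assms by (intro mult_strict_left_mono) auto
  then show ?thesis by (simp add: travel_def reach_def)
qed

lemma travel_mono:
  "(norm (x - y))\<^sup>2 \<le> (norm (x - z))\<^sup>2 \<Longrightarrow> travel x \<Delta> y \<le> travel x \<Delta> z"
  unfolding travel_def by (intro divide_right_mono mult_left_mono) auto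

text \<open>
  The cut at the previous point \<open>p\<close> is at most \<open>l\<close> at \<open>y\<close> although \<open>f y \<ge> l + \<Delta> / 5\<close>. A linearization
  error of at least \<open>\<Delta> / 5\<close> forces a step of length \<open>\<Delta> / (5 M)\<close>, whose square adds to the squared
  distance because \<open>p\<close> is a projection of the center.
\<close>

lemma travel_increase:
  assumes "\<Delta> > 0" "p \<in> X" "y \<in> X"
    and "(norm (x - p))\<^sup>2 + (norm (y - p))\<^sup>2 \<le> (norm (x - y))\<^sup>2"
    and cut: "lin f f' p y \<le> l" and "l + \<Delta> / 5 \<le> f y"
  shows "travel x \<Delta> p + 1 \<le> travel x \<Delta> y"
proof -
  have "\<Delta> / 5 \<le> M * norm (y - p)" using lin_error[of y p] assms by linarith
  then have "\<Delta>\<^sup>2 \<le> (5 * (M * norm (y - p)))\<^sup>2" using assms(1) by (intro power_mono) auto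
  then have "\<Delta>\<^sup>2 \<le> 25 * M\<^sup>2 * (norm (y - p))\<^sup>2" by (simp add: power_mult_distrib)
  then have "25 * M\<^sup>2 * (norm (x - p))\<^sup>2 + \<Delta>\<^sup>2
      \<le> 25 * M\<^sup>2 * ((norm (x - p))\<^sup>2 + (norm (y - p))\<^sup>2)" by (simp add: distrib_left)
  also have "\<dots> \<le> 25 * M\<^sup>2 * (norm (x - y))\<^sup>2" using assms(4) by (intro mult_left_mono) auto
  finally have "(25 * M\<^sup>2 * (norm (x - p))\<^sup>2 + \<Delta>\<^sup>2) / \<Delta>\<^sup>2 \<le> 25 * M\<^sup>2 * (norm (x - y))\<^sup>2 / \<Delta>\<^sup>2"
    by (intro divide_right_mono) auto
  then show ?thesis using assms(1) by (simp add: travel_def add_divide_distrib)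
qed

text \<open>
  The warm start. A point at which \<open>a\<close> lies \<open>2 \<Delta>\<close> below \<open>f x\<close> is at least twice as far from \<open>x\<close> as the
  old level set, because by convexity its midpoint with \<open>x\<close> belongs to the latter. Hence the
  normalized distance already gained is not lost when the gap estimate is doubled.
\<close>

lemma travel_double_gap:
  assumes a: "minorant a" "level_projection x a (f x - \<Delta>) y" and x: "x \<in> X" and \<Delta>: "\<Delta> > 0"
    and z: "z \<in> X" "a z \<le> f x - 2 * \<Delta>"
  shows "travel x \<Delta> y \<le> travel x (2 * \<Delta>) z"
proof -
  let ?w = "(1 - 1/2) *\<^sub>R x + (1/2) *\<^sub>R z"
  have "a ?w \<le> (1 - 1/2) * a x + (1/2) * a z"
    using a(1) x z unfolding minorant_def by (intro convex_onD) auto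
  moreover have "a x \<le> f x" using a(1) x by (simp add: minorant_def)
  ultimately have "a ?w \<le> f x - \<Delta>" using z(2) by simp
  moreover have "?w \<in> X" using convex_X x z by (intro convexD) auto
  ultimately have "norm (x - y) \<le> norm (x - ?w)" using a(2) by (simp add: level_projection_def)
  also have "x - ?w = (1/2) *\<^sub>R (x - z)"
    by (simp add: algebra_simps) (simp flip: scaleR_add_left)
  finally have "(norm (x - y))\<^sup>2 \<le> (norm (x - z) / 2)\<^sup>2" by (intro power_mono) auto
  then have "(norm (x - y))\<^sup>2 \<le> (norm (x - z))\<^sup>2 / 4" by (simp add: power_divide)
  then have "25 * M\<^sup>2 * (norm (x - y))\<^sup>2 / \<Delta>\<^sup>2 \<le> 25 * M\<^sup>2 * ((norm (x - z))\<^sup>2 / 4) / \<Delta>\<^sup>2"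
    by (intro divide_right_mono mult_left_mono) auto
  then show ?thesis by (simp add: travel_def power_mult_distrib)
qed

section \<open>Cost and outcome of a call of BLCI\<close>

text \<open>
  \<open>\<rho>\<close> is the travel that the initial minorant guarantees at the start; it is positive only in warm
  started calls. If \<open>f' xinit = 0\<close> then all gap estimates vanish, and the condition for \<open>\<Delta> = 0\<close>
  makes each call return at its first lower bound test.
\<close>

definition call_pre :: "'a \<Rightarrow> real \<Rightarrow> real \<Rightarrow> ('a \<Rightarrow> real) \<Rightarrow> real \<Rightarrow> bool" where
  "call_pre x \<mu> \<Delta> a \<rho> \<longleftrightarrow>
     x \<in> X \<and> f x \<le> f xinit \<and> \<mu> > 0 \<and> \<Delta> \<ge> 0 \<and> minorant a
     \<and> (\<Delta> = 0 \<longrightarrow> (\<forall>z\<in>X. f x \<le> a z))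
     \<and> \<rho> \<le> reach \<mu> \<Delta> \<and> (\<forall>z\<in>X. a z \<le> f x - \<Delta> \<longrightarrow> \<rho> \<le> travel x \<Delta> z)"

text \<open>
  \<open>u\<close> is the cost of the call so far, where a step with \<open>q\<close> queries costs \<open>q + c\<close>. A query in a
  continued pass is paid for by travel gained above \<open>\<rho>\<close>. The first projection may lie arbitrarily far
  away without having cost more than one query, hence the minimum with \<open>reach\<close> in the state
  \<open>Iter\<close>.
\<close>

definition call_inv :: "real \<Rightarrow> 'a \<Rightarrow> real \<Rightarrow> real \<Rightarrow> real \<Rightarrow> real \<Rightarrow> 'a blci_state \<Rightarrow> bool" where
  "call_inv c x \<mu> \<Delta> \<rho> u s \<longleftrightarrow> (case s of
     Entry \<Rightarrow> u \<le> 0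
   | Iter a xs \<Rightarrow>
       xs \<noteq> [] \<and> set xs \<subseteq> X \<and> minorant a \<and> (\<Delta> = 0 \<longrightarrow> (\<forall>z\<in>X. f x \<le> a z))
       \<and> level_projection x a (f x - \<Delta>) (last xs) \<and> \<rho> \<le> travel x \<Delta> (last xs)
       \<and> u \<le> (1 + c) * (1 + min (travel x \<Delta> (last xs)) (reach \<mu> \<Delta>) - \<rho>)
   | Return a y True \<Rightarrow>
       f x - fstar \<le> max 1 (\<mu> / \<mu>star) * \<Delta> \<and> u \<le> (1 + c) * (1 + reach \<mu> \<Delta> - \<rho>) + c
   | Return a y False \<Rightarrow>
       \<Delta> > 0 \<and> minorant a \<and> level_projection x a (f x - \<Delta>) y
       \<and> f y < f x - 4 * \<Delta> / 5 \<and> travel x \<Delta> y < reach \<mu> \<Delta>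
       \<and> u \<le> (1 + c) * (2 + travel x \<Delta> y - \<rho>))"

text \<open>
  The projection property of the last point, for the current aggregate, and feasibility of the new
  point \<open>y\<close> for that aggregate give the Pythagorean inequality by which the travel grows.
\<close>

lemma pass_in_call:
  assumes pre: "call_pre x \<mu> \<Delta> a0 \<rho>" and inv: "call_inv c x \<mu> \<Delta> \<rho> u (Iter a xs)"
    and pass: "pass X f f' m x (f x - \<Delta>) a xs y a'"
  shows "\<Delta> > 0" "minorant a'" "level_projection x a' (f x - \<Delta>) y" "y \<in> X"
    and "lin f f' (last xs) y \<le> f x - \<Delta>"
    and "(norm (x - last xs))\<^sup>2 + (norm (y - last xs))\<^sup>2 \<le> (norm (x - y))\<^sup>2"
proof -
  have I: "xs \<noteq> []" "set xs \<subseteq> X" "minorant a" "\<Delta> = 0 \<longrightarrow> (\<forall>z\<in>X. f x \<le> a z)"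
    "level_projection x a (f x - \<Delta>) (last xs)"
    using inv by (auto simp: call_inv_def)
  have y: "y \<in> level_set X f f' m (f x - \<Delta>) a xs"
    and lb: "lower_bound X f f' m a xs < ereal (f x - \<Delta>)"
    using pass_project[OF I(3,2) pass] pass by (auto simp: pass_def)
  show "minorant a'" "level_projection x a' (f x - \<Delta>) y"
    using pass_project[OF I(3,2) pass] by auto
  show "y \<in> X" using y by (simp add: level_set_def)
  show "\<Delta> > 0"
  proof (rule ccontr)
    assume "\<not> \<Delta> > 0"
    then have \<Delta>: "\<Delta> = 0" using pre by (simp add: call_pre_def)
    obtain z where z: "z \<in> X" "bundle_model f f' m a xs z < f x - \<Delta>"
      using lb unfolding lower_bound_def by (auto simp: INF_less_iff)
    then have "a z < f x" using bundle_model_less[OF m I(1)] \<Delta> by simp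
    then show False using I(4) \<Delta> z by fastforce
  qed
  show "lin f f' (last xs) y \<le> f x - \<Delta>"
    using y last_in_window[OF m I(1)] I(1) by (simp add: level_set_def last_conv_nth)
  show "(norm (x - last xs))\<^sup>2 + (norm (y - last xs))\<^sup>2 \<le> (norm (x - y))\<^sup>2"
    using y by (intro level_projection_obtuse[OF I(3,5)]) (auto simp: level_set_def)
qed

lemma gap_le_of_level:
  assumes "\<And>z. z \<in> X \<Longrightarrow> f x - \<Delta> \<le> f z" "\<Delta> \<ge> 0"
  shows "f x - fstar \<le> max 1 (\<mu> / \<mu>star) * \<Delta>"
proof -
  obtain z where "z \<in> Xstar" using Xstar by auto
  then have "f x - fstar \<le> 1 * \<Delta>" using assms(1)[of z] Xstar by auto
  also have "\<dots> \<le> max 1 (\<mu> / \<mu>star) * \<Delta>" using assms(2) by (intro mult_right_mono) auto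
  finally show ?thesis .
qed

lemma reach_nonneg: "\<mu> > 0 \<Longrightarrow> \<Delta> \<ge> 0 \<Longrightarrow> 0 \<le> reach \<mu> \<Delta>"
  by (simp add: reach_def)

text \<open>
  Each way of returning True bounds the gap: in the first two a minorant of \<open>f\<close> stays above the level,
  in the third the sublevel set of the aggregate, which contains that of \<open>f\<close>, is far from the center.
\<close>

lemma call_inv_step:
  assumes pre: "call_pre x \<mu> \<Delta> a0 \<rho>" and inv: "call_inv c x \<mu> \<Delta> \<rho> u s" and c: "c \<ge> 0"
    and step: "blci_step X f f' x \<mu> \<Delta> m a0 s q s'"
  shows "call_inv c x \<mu> \<Delta> \<rho> (u + (real q + c)) s'"
  using step
proof cases
  case empty_level
  have "f x - \<Delta> \<le> f z" if z: "z \<in> X" for z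
  proof -
    have "f x - \<Delta> < a0 z" using empty_level(4) z by (auto simp: not_le)
    moreover have "a0 z \<le> f z" using pre z by (simp add: call_pre_def minorant_def)
    ultimately show ?thesis by linarith
  qed
  then have "f x - fstar \<le> max 1 (\<mu> / \<mu>star) * \<Delta>"
    using pre by (intro gap_le_of_level) (auto simp: call_pre_def)
  moreover have "0 \<le> (1 + c) * (1 + reach \<mu> \<Delta> - \<rho>)"
    using pre c by (simp add: call_pre_def)
  ultimately show ?thesis using empty_level inv by (simp add: call_inv_def)
next
  case (start x0)
  have x0: "x0 \<in> X" "a0 x0 \<le> f x - \<Delta>"
    and min: "\<And>z. z \<in> X \<Longrightarrow> a0 z \<le> f x - \<Delta> \<Longrightarrow> (norm (x - x0))\<^sup>2 \<le> (norm (x - z))\<^sup>2"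
    using start(4) by (auto simp: is_arg_min_linorder)
  have "norm (x - x0) \<le> norm (x - z)" if "z \<in> X" "a0 z \<le> f x - \<Delta>" for z
    using min[OF that] by (rule power2_le_imp_le) simp
  then have "level_projection x a0 (f x - \<Delta>) x0" using x0 by (simp add: level_projection_def)
  moreover have "\<rho> \<le> travel x \<Delta> x0" "\<rho> \<le> reach \<mu> \<Delta>" using pre x0 by (auto simp: call_pre_def)
  moreover from this have "(1 + c) * 1 \<le> (1 + c) * (1 + min (travel x \<Delta> x0) (reach \<mu> \<Delta>) - \<rho>)"
    using c by (intro mult_left_mono) auto
  ultimately show ?thesis using start inv pre x0 by (simp add: call_inv_def call_pre_def)
next
  case (lower_bound_reached a xs)
  have I: "xs \<noteq> []" "set xs \<subseteq> X" "minorant a"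
    and u: "u \<le> (1 + c) * (1 + min (travel x \<Delta> (last xs)) (reach \<mu> \<Delta>) - \<rho>)"
    using inv lower_bound_reached by (auto simp: call_inv_def)
  have "f x - \<Delta> \<le> f z" if "z \<in> X" for z
    using lower_bound_le[OF m I(1,3,2)] lower_bound_reached that by blast
  then have "f x - fstar \<le> max 1 (\<mu> / \<mu>star) * \<Delta>"
    using pre by (intro gap_le_of_level) (auto simp: call_pre_def)
  moreover have "u \<le> (1 + c) * (1 + reach \<mu> \<Delta> - \<rho>)"
    by (rule order_trans[OF u], intro mult_left_mono) (use c in auto)
  ultimately show ?thesis using lower_bound_reached by (simp add: call_inv_def)
next
  case (far_away a xs y a')
  note P = pass_in_call[OF pre inv[unfolded far_away(1)] far_away(4)]
  have u: "u \<le> (1 + c) * (1 + min (travel x \<Delta> (last xs)) (reach \<mu> \<Delta>) - \<rho>)"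
    using inv far_away by (auto simp: call_inv_def)
  have \<mu>: "\<mu> > 0" using pre by (simp add: call_pre_def)
  have "f x - fstar \<le> max 1 (\<mu> / \<mu>star) * \<Delta>"
  proof (rule gap_le_of_far_level)
    fix z assume z: "z \<in> X" "f z \<le> f x - \<Delta>"
    then have "a' z \<le> f x - \<Delta>" using P(2) unfolding minorant_def by force
    then have "norm (x - y) \<le> norm (x - z)" using P(3) z by (simp add: level_projection_def)
    then have "(norm (x - y))\<^sup>2 \<le> (norm (x - z))\<^sup>2" by (intro power_mono) auto
    moreover have "2 * \<Delta> / \<mu> \<le> (norm (x - y))\<^sup>2"
      using far_away(5) P(1) \<mu> by (simp add: field_simps power2_eq_square)
    ultimately show "2 * \<Delta> / \<mu> \<le> (norm (x - z))\<^sup>2" by linarith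
  qed (use pre P(1) in \<open>auto simp: call_pre_def\<close>)
  moreover have "u \<le> (1 + c) * (1 + reach \<mu> \<Delta> - \<rho>)"
    by (rule order_trans[OF u], intro mult_left_mono) (use c in auto)
  ultimately show ?thesis using far_away by (simp add: call_inv_def)
next
  case (descent a xs y a')
  note P = pass_in_call[OF pre inv[unfolded descent(1)] descent(4)]
  have u: "u \<le> (1 + c) * (1 + min (travel x \<Delta> (last xs)) (reach \<mu> \<Delta>) - \<rho>)"
    using inv descent by (auto simp: call_inv_def)
  have "travel x \<Delta> (last xs) \<le> travel x \<Delta> y" by (rule travel_mono, rule order_trans[OF _ P(6)]) simp
  then have "u \<le> (1 + c) * (1 + travel x \<Delta> y - \<rho>)"
    by (intro order_trans[OF u] mult_left_mono) (use c in auto)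
  then have "u + (1 + c) \<le> (1 + c) * (2 + travel x \<Delta> y - \<rho>)" by (simp add: algebra_simps)
  then show ?thesis using descent P travel_less_reach[OF descent(5)] by (simp add: call_inv_def)
next
  case (continue a xs y a')
  note P = pass_in_call[OF pre inv[unfolded continue(1)] continue(4)]
  have I: "xs \<noteq> []" "set xs \<subseteq> X" "\<rho> \<le> travel x \<Delta> (last xs)"
    and u: "u \<le> (1 + c) * (1 + min (travel x \<Delta> (last xs)) (reach \<mu> \<Delta>) - \<rho>)"
    using inv continue by (auto simp: call_inv_def)
  have lX: "last xs \<in> X" using I by auto
  have t: "travel x \<Delta> (last xs) + 1 \<le> travel x \<Delta> y"
    by (rule travel_increase[OF P(1) lX P(4,6,5)]) (use continue(6) in simp)
  have r: "travel x \<Delta> y < reach \<mu> \<Delta>" by (rule travel_less_reach[OF continue(5)])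
  have "u \<le> (1 + c) * (travel x \<Delta> y - \<rho>)"
    by (intro order_trans[OF u] mult_left_mono) (use c t in auto)
  then have "u + (1 + c) \<le> (1 + c) * (1 + min (travel x \<Delta> y) (reach \<mu> \<Delta>) - \<rho>)"
    using r by (simp add: algebra_simps)
  then show ?thesis using continue P I t by (simp add: call_inv_def)
qed

lemma call_cost_le:
  assumes "call_pre x \<mu> \<Delta> a0 \<rho>" "call_inv c x \<mu> \<Delta> \<rho> u s" "c \<ge> 0"
  shows "u \<le> (1 + c) * (2 + reach \<mu> \<Delta> - \<rho>) + c"
proof -
  have \<rho>: "\<rho> \<le> reach \<mu> \<Delta>" using assms by (simp add: call_pre_def)
  have m1: "(1 + c) * v \<le> (1 + c) * (2 + reach \<mu> \<Delta> - \<rho>)" if "v \<le> 2 + reach \<mu> \<Delta> - \<rho>" for v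
    using that assms by (intro mult_left_mono) auto
  show ?thesis
  proof (cases s)
    case Entry
    then have "u \<le> 0" using assms by (simp add: call_inv_def)
    moreover have "0 \<le> (1 + c) * (2 + reach \<mu> \<Delta> - \<rho>)" using \<rho> assms by simp
    ultimately show ?thesis using assms by linarith
  next
    case (Iter a xs)
    then have "u \<le> (1 + c) * (1 + min (travel x \<Delta> (last xs)) (reach \<mu> \<Delta>) - \<rho>)"
      using assms by (simp add: call_inv_def)
    also have "\<dots> \<le> (1 + c) * (2 + reach \<mu> \<Delta> - \<rho>)" by (rule m1) simp
    finally show ?thesis using assms by linarith
  next
    case (Return a y b)
    then have "(u \<le> (1 + c) * (1 + reach \<mu> \<Delta> - \<rho>) + c)
        \<or> (u \<le> (1 + c) * (2 + travel x \<Delta> y - \<rho>) \<and> travel x \<Delta> y < reach \<mu> \<Delta>)"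
      using assms(2) by (cases b) (simp_all add: call_inv_def)
    moreover have "(1 + c) * (1 + reach \<mu> \<Delta> - \<rho>) \<le> (1 + c) * (2 + reach \<mu> \<Delta> - \<rho>)"
      by (rule m1) simp
    moreover have "(1 + c) * (2 + travel x \<Delta> y - \<rho>) \<le> (1 + c) * (2 + reach \<mu> \<Delta> - \<rho>)"
      if "travel x \<Delta> y < reach \<mu> \<Delta>" by (rule m1) (use that in simp)
    ultimately show ?thesis using assms(3) by linarith
  qed
qed

lemma call_progress:
  assumes pre: "call_pre x \<mu> \<Delta> a0 \<rho>" and inv: "call_inv c x \<mu> \<Delta> \<rho> u s"
    and s: "\<And>a y b. s \<noteq> Return a y b"
  shows "\<exists>q s'. blci_step X f f' x \<mu> \<Delta> m a0 s q s'"
proof (cases s)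
  case Entry
  let ?C = "{z\<in>X. a0 z \<le> f x - \<Delta>}"
  show ?thesis
  proof (cases "?C = {}")
    case True
    then have "blci_step X f f' x \<mu> \<Delta> m a0 Entry 0 (Return a0 x True)"
      by (rule blci_step.empty_level)
    then show ?thesis using Entry by blast
  next
    case False
    moreover have "closed ?C" using pre closed_convex_sublevel by (simp add: call_pre_def)
    ultimately obtain y where "y \<in> ?C" "\<And>z. z \<in> ?C \<Longrightarrow> dist x y \<le> dist x z"
      using distance_attains_inf[of ?C x] by blast
    then have "is_arg_min (\<lambda>z. (norm (x - z))\<^sup>2) (\<lambda>z. z \<in> X \<and> a0 z \<le> f x - \<Delta>) y"
      by (auto simp: is_arg_min_linorder dist_norm power_mono)
    then have "blci_step X f f' x \<mu> \<Delta> m a0 Entry 1 (Iter a0 [y])" by (rule blci_step.start)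
    then show ?thesis using Entry by blast
  qed
next
  case (Iter a xs)
  have I: "xs \<noteq> []" "set xs \<subseteq> X" "minorant a" "\<Delta> = 0 \<longrightarrow> (\<forall>z\<in>X. f x \<le> a z)"
    "level_projection x a (f x - \<Delta>) (last xs)"
    using inv Iter by (auto simp: call_inv_def)
  have x: "x \<in> X" "\<Delta> \<ge> 0" using pre by (auto simp: call_pre_def)
  show ?thesis
  proof (cases "lower_bound X f f' m a xs \<ge> ereal (f x - \<Delta>)")
    case True
    then show ?thesis unfolding Iter by (intro exI) (rule blci_step.lower_bound_reached)
  next
    case False
    then have lb: "lower_bound X f f' m a xs < ereal (f x - \<Delta>)" by simp
    have "\<Delta> \<noteq> 0"
    proof
      assume \<Delta>: "\<Delta> = 0"
      obtain z where z: "z \<in> X" "bundle_model f f' m a xs z < f x - \<Delta>"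
        using lb unfolding lower_bound_def by (auto simp: INF_less_iff)
      then show False using bundle_model_less[OF m I(1)] \<Delta> I(4) by fastforce
    qed
    have "x \<notin> level_set X f f' m (f x - \<Delta>) a xs"
    proof
      \<comment> \<open>If the aggregate does not cut off the center, then the newest linearization does.\<close>
      assume lev: "x \<in> level_set X f f' m (f x - \<Delta>) a xs"
      then have "last xs = x"
        using level_projection_center[OF I(5) x(1)] by (simp add: level_set_def)
      then have "lin f f' x x \<le> f x - \<Delta>"
        using lev last_in_window[OF m I(1)] I(1) by (auto simp: level_set_def last_conv_nth)
      then show False using \<open>\<Delta> \<noteq> 0\<close> x by (simp add: lin_def)
    qed
    then obtain y a' where p: "pass X f f' m x (f x - \<Delta>) a xs y a'"
      using pass_exists[OF m I(1,2,3) x(1) lb] by blast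
    show ?thesis
      using blci_step.far_away[OF p] blci_step.descent[OF p] blci_step.continue[OF p] Iter
      by (meson linorder_not_less)
  qed
qed (use s in auto)

end

section \<open>The invariant of BLW\<close>

fun outer_index :: "'a blw_state \<Rightarrow> nat" where
  "outer_index (Outer k x \<mu> \<Delta>) = k"
| "outer_index (StepI k x \<mu> \<Delta> s) = k"
| "outer_index (StepII k x \<mu> \<Delta> a s) = k"
| "outer_index (StepIII k x \<mu> \<Delta> a s) = k"

fun center :: "'a blw_state \<Rightarrow> 'a" where
  "center (Outer k x \<mu> \<Delta>) = x"
| "center (StepI k x \<mu> \<Delta> s) = x"
| "center (StepII k x \<mu> \<Delta> a s) = x"
| "center (StepIII k x \<mu> \<Delta> a s) = x"

fun modulus :: "'a blw_state \<Rightarrow> real" where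
  "modulus (Outer k x \<mu> \<Delta>) = \<mu>"
| "modulus (StepI k x \<mu> \<Delta> s) = \<mu>"
| "modulus (StepII k x \<mu> \<Delta> a s) = \<mu>"
| "modulus (StepIII k x \<mu> \<Delta> a s) = \<mu>"

fun is_outer :: "'a blw_state \<Rightarrow> bool" where
  "is_outer (Outer k x \<mu> \<Delta>) = True"
| "is_outer _ = False"

context blw_problem
begin

text \<open>
  The value of \<open>\<mu> \<Delta>\<close> throughout outer iteration \<open>k\<close>.
\<close>

definition estimate_product :: "nat \<Rightarrow> real" where
  "estimate_product k = 2 * (norm (f' xinit))\<^sup>2 * (3 / 4) ^ k"

text \<open>
  The cost allowed up to the end of outer iteration \<open>k\<close>, with \<open>50 M\<^sup>2 / (\<mu> \<Delta>)\<close> being \<open>reach\<close>. Its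
  coefficient is \<open>13 / 4 = 1 + 5 / 4 + 1\<close>: one for the call in step (i), \<open>5 / 4\<close> for that in step (ii),
  where the gap estimate is smaller by the factor \<open>4 / 5\<close>, and one for all calls of step (iii)
  together, thanks to the warm start. The constant 5 counts the first projections of the three steps
  and the two descents that lead from one step to the next. The logarithm is the number of halvings of the modulus; each
  of them comes with two queries that no travel pays for, and three steps.
\<close>

definition budget :: "real \<Rightarrow> nat \<Rightarrow> real \<Rightarrow> real" where
  "budget c k \<mu> = 1 + (\<Sum>j\<in>{1..k}. 13 / 4 * ((1 + c) * (50 * M\<^sup>2 / estimate_product j)) + 5 + 10 * c)
                    + (2 + 3 * c) * log 2 (\<mu>0 / \<mu>)"

definition estimates :: "nat \<Rightarrow> 'a \<Rightarrow> real \<Rightarrow> real \<Rightarrow> bool" where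
  "estimates k x \<mu> \<Delta> \<longleftrightarrow>
     x \<in> X \<and> f x \<le> f xinit \<and> 3 / 10 * \<mu>star \<le> \<mu> \<and> \<mu> * \<Delta> = estimate_product k
     \<and> (\<Delta> = 0 \<longrightarrow> (\<forall>z\<in>X. f x \<le> lin f f' x z))"

text \<open>
  In each cost inequality the left-hand side adds to the cost \<open>C\<close> so far the full allowances of the
  current step and of the rest of outer iteration \<open>k\<close>, further halvings excepted. On the right, the
  current step is credited with what it has spent already: \<open>u\<close> in the running call and, in step (iii),
  \<open>(1 + c) \<rho>\<close> in earlier ones.
  In step (iii) the gap bound mentions the fixed product \<open>\<mu> \<Delta>\<close> instead of \<open>\<mu>\<close>, so that it is
  preserved when \<open>\<Delta>\<close> is doubled.
\<close>

definition run_inv :: "real \<Rightarrow> real \<Rightarrow> 'a blw_state \<Rightarrow> bool" where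
  "run_inv c C s \<longleftrightarrow> (case s of
     Outer k x \<mu> \<Delta> \<Rightarrow>
       estimates k x \<mu> \<Delta> \<and> f x - fstar \<le> max 1 (\<mu> / \<mu>star) * \<Delta> \<and> C \<le> budget c k \<mu>
   | StepI k x \<mu> \<Delta> s \<Rightarrow>
       estimates k x \<mu> \<Delta> \<and> f x - fstar \<le> max 1 (\<mu> / \<mu>star) * (4 / 3 * \<Delta>)
       \<and> (\<exists>u. call_inv c x \<mu> \<Delta> 0 u s
            \<and> C + 13 / 4 * ((1 + c) * reach \<mu> \<Delta>) + (5 + 9 * c) \<le> budget c k \<mu> + u)
   | StepII k x \<mu> \<Delta> a s \<Rightarrow>
       estimates k x \<mu> \<Delta> \<and> \<Delta> > 0 \<and> f x - fstar \<le> max 1 (\<mu> / \<mu>star) * (4 / 3 * \<Delta>)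
       \<and> minorant a \<and> fstar \<le> f x - 4 * \<Delta> / 5
       \<and> (\<exists>u. call_inv c x \<mu> (4 * \<Delta> / 5) 0 u s
            \<and> C + 9 / 4 * ((1 + c) * reach \<mu> \<Delta>) + (3 + 6 * c) \<le> budget c k \<mu> + u)
   | StepIII k x \<mu> \<Delta> a s \<Rightarrow>
       estimates k x \<mu> \<Delta> \<and> \<Delta> > 0
       \<and> f x - fstar \<le> max (52 / 75 * \<Delta>) (4 / 3 * (estimate_product k / \<mu>star))
       \<and> (\<exists>u \<rho>. call_pre x \<mu> \<Delta> a \<rho> \<and> call_inv c x \<mu> \<Delta> \<rho> u s
            \<and> C + (1 + c) * reach \<mu> \<Delta> + (1 + 3 * c) \<le> budget c k \<mu> + (1 + c) * \<rho> + u))"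

lemma estimate_product_nonneg: "0 \<le> estimate_product k"
  by (simp add: estimate_product_def)

lemma estimates_pos:
  assumes "estimates k x \<mu> \<Delta>" shows "\<mu> > 0" "\<Delta> \<ge> 0"
proof -
  show "\<mu> > 0" using assms \<mu>star_pos by (simp add: estimates_def)
  then show "\<Delta> \<ge> 0" using assms estimate_product_nonneg[of k]
    by (metis estimates_def zero_le_mult_iff not_less)
qed

lemma estimates_reach: "estimates k x \<mu> \<Delta> \<Longrightarrow> reach \<mu> \<Delta> = 50 * M\<^sup>2 / estimate_product k"
  by (simp add: estimates_def reach_def)

lemma call_pre_I:
  assumes "estimates k x \<mu> \<Delta>"
  shows "call_pre x \<mu> \<Delta> (lin f f' x) 0"
  using assms estimates_pos[OF assms] reach_nonneg minorant_lin
  by (auto simp: call_pre_def estimates_def)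

lemma call_pre_II:
  assumes "estimates k x \<mu> \<Delta>" "\<Delta> > 0" "minorant a"
  shows "call_pre x \<mu> (4 * \<Delta> / 5) a 0"
  using assms estimates_pos[OF assms(1)] reach_nonneg[of \<mu> "4 * \<Delta> / 5"]
  by (auto simp: call_pre_def estimates_def)

lemma budget_Suc:
  "budget c (Suc k) \<mu> = budget c k \<mu> + (13 / 4 * ((1 + c) * (50 * M\<^sup>2 / estimate_product (Suc k))) + 5 + 10 * c)"
  by (simp add: budget_def)

lemma budget_halve:
  assumes "\<mu> > 0"
  shows "budget c k (\<mu> / 2) = budget c k \<mu> + (2 + 3 * c)"
proof -
  have "\<mu>0 > 0" using \<mu>0 \<mu>star_pos by simp
  then have "log 2 (\<mu>0 / (\<mu> / 2)) = log 2 (\<mu>0 / \<mu>) + 1"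
    using assms by (simp add: log_divide log_mult)
  then show ?thesis by (simp add: budget_def algebra_simps)
qed

text \<open>
  If \<open>\<mu> \<le> \<mu>\<^sup>*\<close> then the gap was at most \<open>4 / 3 \<Delta>\<close> at the old center \<open>x\<close>, the move to \<open>z\<close> lowers
  it by \<open>16 / 25 \<Delta>\<close>, and \<open>4 / 3 - 16 / 25 = 52 / 75\<close>. A halving needs a gap of more
  than \<open>4 / 5 \<Delta>\<close>, which this excludes.
\<close>

lemma new_center_gap:
  assumes est: "estimates k x \<mu> \<Delta>"
    and gap: "f x - fstar \<le> max 1 (\<mu> / \<mu>star) * (4 / 3 * \<Delta>)"
    and z: "f z < f x - 4 * (4 * \<Delta> / 5) / 5"
  shows "f z - fstar \<le> max (52 / 75 * \<Delta>) (4 / 3 * (estimate_product k / \<mu>star))"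
proof (cases "\<mu> / \<mu>star \<le> 1")
  case True
  then show ?thesis using gap z by (simp add: max_def split: if_splits)
next
  case False
  have "\<Delta> \<ge> 0" using estimates_pos[OF est] by simp
  then have "f z - fstar \<le> \<mu> / \<mu>star * (4 / 3 * \<Delta>)" using gap z False by (simp add: max_def)
  also have "\<dots> = 4 / 3 * (\<mu> * \<Delta> / \<mu>star)" by simp
  also have "\<mu> * \<Delta> = estimate_product k" using est by (simp add: estimates_def)
  finally show ?thesis by simp
qed

text \<open>
  On leaving one of the steps (i) to (iii), the bound on the cost of its calls releases its allowance.
  At a halving, the point found shows that the gap exceeds \<open>4 / 5 \<Delta>\<close>, which the gap bound of step (iii)
  allows only for \<open>\<mu> > 3 / 5 \<mu>\<^sup>*\<close>; the halved estimate is still above \<open>3 / 10 \<mu>\<^sup>*\<close>.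
\<close>

lemma run_inv_step:
  assumes inv: "run_inv c C s" and c: "c \<ge> 0" and step: "blw_step X f f' m s q s'"
  shows "run_inv c (C + (real q + c)) s'"
  using step
proof cases
  case (next_outer k x \<mu> \<Delta>)
  have e: "estimates k x \<mu> \<Delta>" and gap: "f x - fstar \<le> max 1 (\<mu> / \<mu>star) * \<Delta>"
    and C: "C \<le> budget c k \<mu>" using inv next_outer by (auto simp: run_inv_def)
  have e': "estimates (Suc k) x \<mu> (3 / 4 * \<Delta>)"
    using e by (simp add: estimates_def estimate_product_def)
  have "call_inv c x \<mu> (3 / 4 * \<Delta>) 0 0 Entry" by (simp add: call_inv_def)
  moreover have "C + c + 13 / 4 * ((1 + c) * reach \<mu> (3 / 4 * \<Delta>)) + (5 + 9 * c)
      \<le> budget c (Suc k) \<mu> + 0"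
    using C unfolding budget_Suc estimates_reach[OF e', symmetric] by (simp add: algebra_simps)
  ultimately show ?thesis using next_outer e' gap by (auto simp: run_inv_def)
next
  case (run_I x \<mu> \<Delta> t t' k)
  have e: "estimates k x \<mu> \<Delta>" and gap: "f x - fstar \<le> max 1 (\<mu> / \<mu>star) * (4 / 3 * \<Delta>)"
    using inv run_I by (auto simp: run_inv_def)
  obtain u where u: "call_inv c x \<mu> \<Delta> 0 u t"
    "C + 13 / 4 * ((1 + c) * reach \<mu> \<Delta>) + (5 + 9 * c) \<le> budget c k \<mu> + u"
    using inv run_I by (auto simp: run_inv_def)
  have "call_inv c x \<mu> \<Delta> 0 (u + (real q + c)) t'"
    by (rule call_inv_step[OF call_pre_I[OF e] u(1) c run_I(3)])
  moreover have "C + (real q + c) + 13 / 4 * ((1 + c) * reach \<mu> \<Delta>) + (5 + 9 * c)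
      \<le> budget c k \<mu> + (u + (real q + c))" using u(2) by linarith
  ultimately show ?thesis unfolding run_I run_inv_def blw_state.case using e gap by blast
next
  case (true_I k x \<mu> \<Delta> a y)
  have e: "estimates k x \<mu> \<Delta>" using inv true_I by (auto simp: run_inv_def)
  obtain u where u: "call_inv c x \<mu> \<Delta> 0 u (Return a y True)"
    "C + 13 / 4 * ((1 + c) * reach \<mu> \<Delta>) + (5 + 9 * c) \<le> budget c k \<mu> + u"
    using inv true_I by (auto simp: run_inv_def)
  have g: "f x - fstar \<le> max 1 (\<mu> / \<mu>star) * \<Delta>" "u \<le> (1 + c) * (1 + reach \<mu> \<Delta> - 0) + c"
    using u by (auto simp: call_inv_def)
  have "0 \<le> (1 + c) * reach \<mu> \<Delta>" using c reach_nonneg estimates_pos[OF e] by simp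
  moreover have "u \<le> (1 + c) * reach \<mu> \<Delta> + (1 + 2 * c)" using g(2) by (simp add: algebra_simps)
  ultimately have "C + c \<le> budget c k \<mu>" using u(2) c by linarith
  then show ?thesis using true_I e g by (simp add: run_inv_def)
next
  case (false_I k x \<mu> \<Delta> a y)
  have e: "estimates k x \<mu> \<Delta>" and gap: "f x - fstar \<le> max 1 (\<mu> / \<mu>star) * (4 / 3 * \<Delta>)"
    using inv false_I by (auto simp: run_inv_def)
  obtain u where u: "call_inv c x \<mu> \<Delta> 0 u (Return a y False)"
    "C + 13 / 4 * ((1 + c) * reach \<mu> \<Delta>) + (5 + 9 * c) \<le> budget c k \<mu> + u"
    using inv false_I by (auto simp: run_inv_def)
  have r: "\<Delta> > 0" "minorant a" "y \<in> X" "f y < f x - 4 * \<Delta> / 5" "travel x \<Delta> y < reach \<mu> \<Delta>"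
    "u \<le> (1 + c) * (2 + travel x \<Delta> y - 0)"
    using u by (auto simp: call_inv_def level_projection_def)
  have "fstar \<le> f x - 4 * \<Delta> / 5" using fstar_le[OF r(3)] r(4) by simp
  moreover have "u \<le> (1 + c) * (2 + reach \<mu> \<Delta>)"
    by (rule order_trans[OF r(6)], rule mult_left_mono) (use r(5) c in auto)
  then have "u \<le> (1 + c) * reach \<mu> \<Delta> + (2 + 2 * c)" by (simp add: algebra_simps)
  then have "C + c + 9 / 4 * ((1 + c) * reach \<mu> \<Delta>) + (3 + 6 * c) \<le> budget c k \<mu> + 0"
    using u(2) by linarith
  moreover have "call_inv c x \<mu> (4 * \<Delta> / 5) 0 0 Entry" by (simp add: call_inv_def)
  ultimately show ?thesis
    using e gap r(1,2) unfolding false_I run_inv_def blw_state.case by auto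
next
  case (run_II x \<mu> \<Delta> a t t' k)
  have e: "estimates k x \<mu> \<Delta>" and gap: "f x - fstar \<le> max 1 (\<mu> / \<mu>star) * (4 / 3 * \<Delta>)"
    and r: "\<Delta> > 0" "minorant a" "fstar \<le> f x - 4 * \<Delta> / 5"
    using inv run_II by (auto simp: run_inv_def)
  obtain u where u: "call_inv c x \<mu> (4 * \<Delta> / 5) 0 u t"
    "C + 9 / 4 * ((1 + c) * reach \<mu> \<Delta>) + (3 + 6 * c) \<le> budget c k \<mu> + u"
    using inv run_II by (auto simp: run_inv_def)
  have "call_inv c x \<mu> (4 * \<Delta> / 5) 0 (u + (real q + c)) t'"
    by (rule call_inv_step[OF call_pre_II[OF e r(1,2)] u(1) c run_II(3)])
  moreover have "C + (real q + c) + 9 / 4 * ((1 + c) * reach \<mu> \<Delta>) + (3 + 6 * c)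
      \<le> budget c k \<mu> + (u + (real q + c))" using u(2) by linarith
  ultimately show ?thesis unfolding run_II run_inv_def blw_state.case using e gap r by blast
next
  case (true_II k x \<mu> \<Delta> a a' y)
  have e: "estimates k x \<mu> \<Delta>" and \<Delta>: "\<Delta> > 0" using inv true_II by (auto simp: run_inv_def)
  obtain u where u: "call_inv c x \<mu> (4 * \<Delta> / 5) 0 u (Return a' y True)"
    "C + 9 / 4 * ((1 + c) * reach \<mu> \<Delta>) + (3 + 6 * c) \<le> budget c k \<mu> + u"
    using inv true_II by (auto simp: run_inv_def)
  have g: "f x - fstar \<le> max 1 (\<mu> / \<mu>star) * (4 * \<Delta> / 5)"
    "u \<le> (1 + c) * (1 + reach \<mu> (4 * \<Delta> / 5) - 0) + c"
    using u by (auto simp: call_inv_def)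
  have gap: "f x - fstar \<le> max 1 (\<mu> / \<mu>star) * \<Delta>"
    by (rule order_trans[OF g(1)], rule mult_left_mono) (use \<Delta> in auto)
  have rr: "reach \<mu> (4 * \<Delta> / 5) = 5 / 4 * reach \<mu> \<Delta>"
    by (simp add: reach_def field_simps)
  have "0 \<le> (1 + c) * reach \<mu> \<Delta>" using c reach_nonneg estimates_pos[OF e] by simp
  moreover have "u \<le> 5 / 4 * ((1 + c) * reach \<mu> \<Delta>) + (1 + 2 * c)"
    using g(2) unfolding rr by (simp add: algebra_simps add_divide_distrib)
  ultimately have C: "C + c \<le> budget c k \<mu>" using u(2) c by linarith
  show ?thesis using true_II e C gap by (simp add: run_inv_def)
next
  case (false_II k x \<mu> \<Delta> a a' z)
  have e: "estimates k x \<mu> \<Delta>" and gap: "f x - fstar \<le> max 1 (\<mu> / \<mu>star) * (4 / 3 * \<Delta>)"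
    and \<Delta>: "\<Delta> > 0" using inv false_II by (auto simp: run_inv_def)
  obtain u where u: "call_inv c x \<mu> (4 * \<Delta> / 5) 0 u (Return a' z False)"
    "C + 9 / 4 * ((1 + c) * reach \<mu> \<Delta>) + (3 + 6 * c) \<le> budget c k \<mu> + u"
    using inv false_II by (auto simp: run_inv_def)
  have r: "z \<in> X" "f z < f x - 4 * (4 * \<Delta> / 5) / 5"
    "travel x (4 * \<Delta> / 5) z < reach \<mu> (4 * \<Delta> / 5)"
    "u \<le> (1 + c) * (2 + travel x (4 * \<Delta> / 5) z - 0)"
    using u by (auto simp: call_inv_def level_projection_def)
  have e': "estimates k z \<mu> \<Delta>" using e r \<Delta> by (auto simp: estimates_def)
  have rr: "reach \<mu> (4 * \<Delta> / 5) = 5 / 4 * reach \<mu> \<Delta>"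
    by (simp add: reach_def field_simps)
  have "u \<le> (1 + c) * (2 + 5 / 4 * reach \<mu> \<Delta>)"
    by (rule order_trans[OF r(4)], rule mult_left_mono) (use r(3) rr c in auto)
  then have "u \<le> 5 / 4 * ((1 + c) * reach \<mu> \<Delta>) + (2 + 2 * c)"
    by (simp add: algebra_simps add_divide_distrib)
  then have "C + c + (1 + c) * reach \<mu> \<Delta> + (1 + 3 * c) \<le> budget c k \<mu> + (1 + c) * 0 + 0"
    using u(2) by simp
  moreover have "call_inv c z \<mu> \<Delta> 0 0 Entry" by (simp add: call_inv_def)
  moreover note call_pre_I[OF e']
  ultimately have "\<exists>u \<rho>. call_pre z \<mu> \<Delta> (lin f f' z) \<rho> \<and> call_inv c z \<mu> \<Delta> \<rho> u Entry
      \<and> C + (real q + c) + (1 + c) * reach \<mu> \<Delta> + (1 + 3 * c) \<le> budget c k \<mu> + (1 + c) * \<rho> + u"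
    using false_II(2) by (intro exI[of _ 0]) simp
  then show ?thesis
    unfolding false_II run_inv_def blw_state.case
    using new_center_gap[OF e gap r(2)] e' \<Delta> false_II(2) by simp
next
  case (run_III x \<mu> \<Delta> a t t' k)
  have e: "estimates k x \<mu> \<Delta>" and \<Delta>: "\<Delta> > 0"
    and gap: "f x - fstar \<le> max (52 / 75 * \<Delta>) (4 / 3 * (estimate_product k / \<mu>star))"
    using inv run_III by (auto simp: run_inv_def)
  obtain u \<rho> where u: "call_pre x \<mu> \<Delta> a \<rho>" "call_inv c x \<mu> \<Delta> \<rho> u t"
    "C + (1 + c) * reach \<mu> \<Delta> + (1 + 3 * c) \<le> budget c k \<mu> + (1 + c) * \<rho> + u"
    using inv run_III by (auto simp: run_inv_def)
  have "call_inv c x \<mu> \<Delta> \<rho> (u + (real q + c)) t'"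
    by (rule call_inv_step[OF u(1,2) c run_III(3)])
  moreover have "C + (real q + c) + (1 + c) * reach \<mu> \<Delta> + (1 + 3 * c)
      \<le> budget c k \<mu> + (1 + c) * \<rho> + (u + (real q + c))" using u(3) by linarith
  ultimately show ?thesis unfolding run_III run_inv_def blw_state.case using e \<Delta> gap u(1) by blast
next
  case (true_III k x \<mu> \<Delta> a a' y)
  have e: "estimates k x \<mu> \<Delta>" using inv true_III by (auto simp: run_inv_def)
  obtain u \<rho> where u: "call_inv c x \<mu> \<Delta> \<rho> u (Return a' y True)"
    "C + (1 + c) * reach \<mu> \<Delta> + (1 + 3 * c) \<le> budget c k \<mu> + (1 + c) * \<rho> + u"
    using inv true_III by (auto simp: run_inv_def)
  have g: "f x - fstar \<le> max 1 (\<mu> / \<mu>star) * \<Delta>" "u \<le> (1 + c) * (1 + reach \<mu> \<Delta> - \<rho>) + c"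
    using u by (auto simp: call_inv_def)
  have "C + c \<le> budget c k \<mu>" using u(2) g(2) c by (simp add: algebra_simps)
  then show ?thesis using true_III e g by (simp add: run_inv_def)
next
  case (false_III k x \<mu> \<Delta> a a' y)
  have e: "estimates k x \<mu> \<Delta>" and \<Delta>: "\<Delta> > 0"
    and gap: "f x - fstar \<le> max (52 / 75 * \<Delta>) (4 / 3 * (estimate_product k / \<mu>star))"
    using inv false_III by (auto simp: run_inv_def)
  obtain u \<rho> where u: "call_pre x \<mu> \<Delta> a \<rho>" "call_inv c x \<mu> \<Delta> \<rho> u (Return a' y False)"
    "C + (1 + c) * reach \<mu> \<Delta> + (1 + 3 * c) \<le> budget c k \<mu> + (1 + c) * \<rho> + u"
    using inv false_III by (auto simp: run_inv_def)
  define \<rho>' where "\<rho>' = travel x \<Delta> y"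
  have r: "minorant a'" "level_projection x a' (f x - \<Delta>) y" "y \<in> X" "f y < f x - 4 * \<Delta> / 5"
    "\<rho>' < reach \<mu> \<Delta>" "u \<le> (1 + c) * (2 + \<rho>' - \<rho>)"
    using u by (auto simp: call_inv_def level_projection_def \<rho>'_def)
  have x: "x \<in> X" and \<mu>: "\<mu> > 0" using e estimates_pos[OF e] by (auto simp: estimates_def)
  have "4 / 5 * \<Delta> < f x - fstar" using fstar_le[OF r(3)] r(4) by simp
  \<comment> \<open>The first term of the maximum is less than \<open>4 / 5 * \<Delta>\<close>, so the second one bounds the gap.\<close>
  then have "4 / 5 * \<Delta> < 4 / 3 * (\<mu> * \<Delta> / \<mu>star)"
    using gap \<Delta> e by (auto simp: max_def estimates_def split: if_splits)
  then have "3 / 5 * \<mu>star < \<mu>" using \<Delta> \<mu>star_pos by (simp add: field_simps)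
  then have e': "estimates k x (\<mu> / 2) (2 * \<Delta>)" using e \<Delta> by (simp add: estimates_def)
  have rr: "reach (\<mu> / 2) (2 * \<Delta>) = reach \<mu> \<Delta>" by (simp add: reach_def)
  have pre: "call_pre x (\<mu> / 2) (2 * \<Delta>) a' \<rho>'"
    using r x \<mu> \<Delta> rr travel_double_gap[OF r(1,2) x \<Delta>] e
    by (auto simp: call_pre_def estimates_def \<rho>'_def)
  have "C + c + (1 + c) * reach (\<mu> / 2) (2 * \<Delta>) + (1 + 3 * c)
      \<le> budget c k (\<mu> / 2) + (1 + c) * \<rho>' + 0"
    using u(3) r(6) unfolding rr budget_halve[OF \<mu>] by (simp add: algebra_simps)
  moreover have "call_inv c x (\<mu> / 2) (2 * \<Delta>) \<rho>' 0 Entry" by (simp add: call_inv_def)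
  moreover have "f x - fstar \<le> max (52 / 75 * (2 * \<Delta>)) (4 / 3 * (estimate_product k / \<mu>star))"
    using gap \<Delta> by (auto simp: max_def split: if_splits)
  ultimately show ?thesis
    unfolding false_III run_inv_def blw_state.case using e' pre \<Delta> false_III(2)
    by (intro conjI exI[of _ 0] exI[of _ \<rho>']) auto
qed

text \<open>
  The center moves only after step (ii), to a projection onto the level set of a minorant at the level
  \<open>f x - 4 \<Delta> / 5\<close>. The point found in step (i) shows that the minimal value is below this level, so the
  level set contains all minimizers, and the projection comes closer to each of them.
\<close>

lemma center_step:
  assumes inv: "run_inv c C s" and step: "blw_step X f f' m s q s'"
  shows "infdist (center s') Xstar \<le> infdist (center s) Xstar"
  using step
proof cases
  case (false_II k x \<mu> \<Delta> a a' z)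
  obtain u where "call_inv c x \<mu> (4 * \<Delta> / 5) 0 u (Return a' z False)"
    and *: "fstar \<le> f x - 4 * \<Delta> / 5"
    using inv false_II by (auto simp: run_inv_def)
  then have r: "minorant a'" "level_projection x a' (f x - 4 * \<Delta> / 5) z"
    by (auto simp: call_inv_def)
  have "infdist z Xstar \<le> dist x p" if p: "p \<in> Xstar" for p
  proof -
    have pX: "p \<in> X" using p Xstar by auto
    have "a' p \<le> f p" using r(1) pX by (simp add: minorant_def)
    then have "a' p \<le> f x - 4 * \<Delta> / 5" using * Xstar(3)[OF p] by simp
    then have "(norm (x - z))\<^sup>2 + (norm (p - z))\<^sup>2 \<le> (norm (x - p))\<^sup>2"
      by (rule level_projection_obtuse[OF r pX])
    then have "(norm (p - z))\<^sup>2 \<le> (norm (x - p))\<^sup>2" by (rule order_trans[rotated]) simp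
    then have "norm (p - z) \<le> norm (x - p)" by (rule power2_le_imp_le) simp
    then have "dist z p \<le> dist x p" by (simp add: dist_norm norm_minus_commute)
    then show ?thesis using infdist_le2[OF p] by blast
  qed
  then have "infdist z Xstar \<le> infdist x Xstar"
    unfolding infdist_notempty[OF Xstar(2), of x] by (intro cINF_greatest[OF Xstar(2)])
  then show ?thesis using false_II by simp
qed simp_all

lemma run_progress:
  assumes inv: "run_inv c C s"
  shows "\<exists>q s'. blw_step X f f' m s q s'"
proof (cases s)
  case (Outer k x \<mu> \<Delta>)
  then show ?thesis using blw_step.next_outer by metis
next
  case (StepI k x \<mu> \<Delta> t)
  then have e: "estimates k x \<mu> \<Delta>" and "\<exists>u. call_inv c x \<mu> \<Delta> 0 u t"
    using inv by (auto simp: run_inv_def)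
  then obtain u where u: "call_inv c x \<mu> \<Delta> 0 u t" by blast
  show ?thesis
  proof (cases "\<exists>a y b. t = Return a y b")
    case True
    then obtain a y b where "t = Return a y b" by blast
    then show ?thesis
      using StepI by (cases b) (auto intro: blw_step.true_I blw_step.false_I)
  next
    case False
    then show ?thesis
      using call_progress[OF call_pre_I[OF e] u] StepI by (auto intro: blw_step.run_I)
  qed
next
  case (StepII k x \<mu> \<Delta> a t)
  then have e: "estimates k x \<mu> \<Delta>" "\<Delta> > 0" "minorant a"
    and "\<exists>u. call_inv c x \<mu> (4 * \<Delta> / 5) 0 u t"
    using inv by (auto simp: run_inv_def)
  then obtain u where u: "call_inv c x \<mu> (4 * \<Delta> / 5) 0 u t" by blast
  show ?thesis
  proof (cases "\<exists>a y b. t = Return a y b")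
    case True
    then obtain a y b where "t = Return a y b" by blast
    then show ?thesis
      using StepII by (cases b) (auto intro: blw_step.true_II blw_step.false_II)
  next
    case False
    then show ?thesis
      using call_progress[OF call_pre_II[OF e] u] StepII by (auto intro: blw_step.run_II)
  qed
next
  case (StepIII k x \<mu> \<Delta> a t)
  then obtain \<rho> u where u: "call_pre x \<mu> \<Delta> a \<rho>" "call_inv c x \<mu> \<Delta> \<rho> u t"
    using inv by (auto simp: run_inv_def)
  show ?thesis
  proof (cases "\<exists>a y b. t = Return a y b")
    case True
    then obtain a y b where "t = Return a y b" by blast
    then show ?thesis
      using StepIII by (cases b) (auto intro: blw_step.true_III blw_step.false_III)
  next
    case False
    then show ?thesis
      using call_progress[OF u] StepIII by (auto intro: blw_step.run_III)
  qed
qed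

text \<open>
  Within an outer iteration the cost exceeds the budget by at most 1. Only finiteness of the bound
  matters, since it excludes runs that stay in one outer iteration forever.
\<close>

lemma run_inv_cost:
  assumes inv: "run_inv c C s" and c: "c \<ge> 0"
  shows "C \<le> budget c (outer_index s) (modulus s) + 1" "3 / 10 * \<mu>star \<le> modulus s"
proof -
  show "3 / 10 * \<mu>star \<le> modulus s"
    using inv by (cases s) (auto simp: run_inv_def estimates_def)
  show "C \<le> budget c (outer_index s) (modulus s) + 1"
  proof (cases s)
    case (Outer k x \<mu> \<Delta>)
    then show ?thesis using inv by (auto simp: run_inv_def)
  next
    case (StepI k x \<mu> \<Delta> t)
    then obtain u where e: "estimates k x \<mu> \<Delta>" and u: "call_inv c x \<mu> \<Delta> 0 u t"
      "C + 13 / 4 * ((1 + c) * reach \<mu> \<Delta>) + (5 + 9 * c) \<le> budget c k \<mu> + u"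
      using inv by (auto simp: run_inv_def)
    have "0 \<le> (1 + c) * reach \<mu> \<Delta>" using c reach_nonneg estimates_pos[OF e] by simp
    moreover have "u \<le> (1 + c) * reach \<mu> \<Delta> + (2 + 3 * c)"
      using call_cost_le[OF call_pre_I[OF e] u(1) c] by (simp add: algebra_simps)
    ultimately have "C \<le> budget c k \<mu>" using u(2) c by linarith
    then show ?thesis using StepI by simp
  next
    case (StepII k x \<mu> \<Delta> a t)
    then obtain u where e: "estimates k x \<mu> \<Delta>" "\<Delta> > 0" "minorant a"
      and u: "call_inv c x \<mu> (4 * \<Delta> / 5) 0 u t"
      "C + 9 / 4 * ((1 + c) * reach \<mu> \<Delta>) + (3 + 6 * c) \<le> budget c k \<mu> + u"
      using inv by (auto simp: run_inv_def)
    have rr: "reach \<mu> (4 * \<Delta> / 5) = 5 / 4 * reach \<mu> \<Delta>" by (simp add: reach_def field_simps)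
    have "0 \<le> (1 + c) * reach \<mu> \<Delta>" using c reach_nonneg estimates_pos[OF e(1)] by simp
    moreover have "u \<le> 5 / 4 * ((1 + c) * reach \<mu> \<Delta>) + (2 + 3 * c)"
      using call_cost_le[OF call_pre_II[OF e] u(1) c, unfolded rr]
      by (simp add: algebra_simps add_divide_distrib)
    ultimately have "C \<le> budget c k \<mu>" using u(2) c by linarith
    then show ?thesis using StepII by simp
  next
    case (StepIII k x \<mu> \<Delta> a t)
    then obtain u \<rho> where u: "call_pre x \<mu> \<Delta> a \<rho>" "call_inv c x \<mu> \<Delta> \<rho> u t"
      "C + (1 + c) * reach \<mu> \<Delta> + (1 + 3 * c) \<le> budget c k \<mu> + (1 + c) * \<rho> + u"
      using inv by (auto simp: run_inv_def)
    then show ?thesis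
      using call_cost_le[OF u(1,2) c] u(3) c StepIII by (simp add: algebra_simps)
  qed
qed

lemma run_inv_init:
  "run_inv c 1 (Outer 0 xinit \<mu>0 (2 * (norm (f' xinit))\<^sup>2 / \<mu>0))"
proof -
  define \<Delta> where "\<Delta> = 2 * (norm (f' xinit))\<^sup>2 / \<mu>0"
  have \<mu>0_pos: "\<mu>0 > 0" using \<mu>0 \<mu>star_pos by simp
  have p: "\<mu>0 * \<Delta> = 2 * (norm (f' xinit))\<^sup>2" using \<mu>0_pos by (simp add: \<Delta>_def)
  \<comment> \<open>A zero gap estimate comes from a zero subgradient, whose linearization is constant.\<close>
  have "\<Delta> = 0 \<longrightarrow> f' xinit = 0" using \<mu>0_pos by (simp add: \<Delta>_def)
  then have "estimates 0 xinit \<mu>0 \<Delta>"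
    using p xinit \<mu>0 \<mu>star_pos by (auto simp: estimates_def estimate_product_def lin_def)
  moreover have "f xinit - fstar \<le> max 1 (\<mu>0 / \<mu>star) * \<Delta>"
  proof -
    have "f xinit - fstar \<le> \<mu>0 / \<mu>star * \<Delta>" using initial_gap p by (simp add: field_simps)
    also have "\<dots> \<le> max 1 (\<mu>0 / \<mu>star) * \<Delta>" using \<mu>0_pos by (intro mult_right_mono) (auto simp: \<Delta>_def)
    finally show ?thesis .
  qed
  moreover have "1 \<le> budget c 0 \<mu>0" using \<mu>0_pos by (simp add: budget_def)
  ultimately show ?thesis by (simp add: run_inv_def \<Delta>_def)
qed

lemma prefix_inv:
  assumes "blw_prefix X f f' xinit \<mu>0 m L \<sigma> N" "n \<le> L" "c \<ge> 0"
  shows "run_inv c (real (N n) + c * real n) (\<sigma> n)"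
  using assms(2)
proof (induction n)
  case 0
  then show ?case using assms(1) run_inv_init[of c] by (simp add: blw_prefix_def)
next
  case (Suc n)
  then have "\<exists>q. blw_step X f f' m (\<sigma> n) q (\<sigma> (Suc n)) \<and> N (Suc n) = N n + q"
    using assms(1) by (simp add: blw_prefix_def)
  then obtain q where "blw_step X f f' m (\<sigma> n) q (\<sigma> (Suc n))" "N (Suc n) = N n + q" by blast
  then show ?case
    using run_inv_step[OF _ assms(3), of "real (N n) + c * real n" "\<sigma> n" q "\<sigma> (Suc n)"] Suc
    by (simp add: algebra_simps)
qed

end

lemma outer_index_step:
  assumes "blw_step X f f' m s q s'"
  shows "outer_index s' = (if is_outer s then Suc (outer_index s) else outer_index s)"
  using assms by cases auto

text \<open>
  The outer index grows only on leaving an \<open>Outer\<close> state. If there were none with index \<open>k + 1\<close>, the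
  index would stay at \<open>k + 1\<close> forever and the number of steps would be bounded.
\<close>

lemma outer_reached:
  fixes bound :: "nat \<Rightarrow> real"
  assumes step: "\<And>n. \<exists>q. blw_step X f f' m (\<sigma> n) q (\<sigma> (Suc n))"
    and init: "is_outer (\<sigma> 0)" "outer_index (\<sigma> 0) = 0"
    and bound: "\<And>n. real n \<le> bound (outer_index (\<sigma> n))"
  shows "\<exists>n. is_outer (\<sigma> n) \<and> outer_index (\<sigma> n) = k"
proof (induction k)
  case 0
  then show ?case using init by blast
next
  case (Suc k)
  then obtain n0 where n0: "is_outer (\<sigma> n0)" "outer_index (\<sigma> n0) = k" by blast
  show ?case
  proof (rule ccontr)
    assume no: "\<not> ?thesis"
    have idx: "outer_index (\<sigma> (Suc n0 + i)) = Suc k" for i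
    proof (induction i)
      case 0
      then show ?case using outer_index_step step[of n0] n0 by fastforce
    next
      case (Suc i)
      then have "\<not> is_outer (\<sigma> (Suc n0 + i))" using no by blast
      then show ?case using outer_index_step step[of "Suc n0 + i"] Suc by fastforce
    qed
    obtain i :: nat where "bound (Suc k) < real i" using reals_Archimedean2 by blast
    then show False using bound[of "Suc n0 + i"] idx[of i] by simp
  qed
qed

lemma outer_index_mono:
  assumes step: "\<And>n. \<exists>q. blw_step X f f' m (\<sigma> n) q (\<sigma> (Suc n))" and "i \<le> j"
  shows "outer_index (\<sigma> i) \<le> outer_index (\<sigma> j)"
proof (rule lift_Suc_mono_le[OF _ assms(2)])
  fix n
  obtain q where "blw_step X f f' m (\<sigma> n) q (\<sigma> (Suc n))" using step by blast
  then show "outer_index (\<sigma> n) \<le> outer_index (\<sigma> (Suc n))" by (simp add: outer_index_step)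
qed

section \<open>Accuracy and number of queries\<close>

text \<open>
  The second bound expresses the minimality of \<open>S\<close>. For \<open>Q = 0\<close> the convention \<open>log b 0 = 0\<close>
  makes \<open>S = 0\<close>.
\<close>

lemma log_ceiling_bounds:
  fixes b Q :: real
  assumes b: "b > 1" and Q: "Q \<ge> 0" and S: "int S = max 0 \<lceil>log b Q\<rceil>"
  shows "Q \<le> b ^ S" "S \<ge> 1 \<Longrightarrow> b ^ S < b * Q"
proof -
  show "Q \<le> b ^ S"
  proof (cases "Q = 0")
    case False
    then have "log b Q \<le> real S" using S by linarith
    then show ?thesis using b Q False by (simp add: log_le_iff powr_realpow)
  qed (use b in simp)
  show "b ^ S < b * Q" if S1: "S \<ge> 1"
  proof -
    have "Q \<noteq> 0" using S S1 by (auto simp: log_def)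
    have "real S - 1 < log b Q" using S S1 by linarith
    then have "real S < log b (b * Q)" using b Q \<open>Q \<noteq> 0\<close> by (simp add: log_mult)
    then show ?thesis using b Q \<open>Q \<noteq> 0\<close> by (simp add: less_log_iff powr_realpow)
  qed
qed

context blw_problem
begin

lemma log_modulus_le:
  assumes "3 / 10 * \<mu>star \<le> \<mu>"
  shows "log 2 (\<mu>0 / \<mu>) \<le> log 2 (4 * \<mu>0 / \<mu>star)"
proof -
  have pos: "\<mu> > 0" "\<mu>0 > 0" using assms \<mu>0 \<mu>star_pos by auto
  have "\<mu>star \<le> 4 * \<mu>" using assms \<mu>star_pos by linarith
  then have "\<mu>0 * \<mu>star \<le> \<mu>0 * (4 * \<mu>)" using pos by (intro mult_left_mono) auto
  then have "\<mu>0 / \<mu> \<le> 4 * \<mu>0 / \<mu>star" using pos \<mu>star_pos by (simp add: field_simps)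
  then show ?thesis using pos \<mu>star_pos by (subst log_le_cancel_iff) auto
qed

text \<open>
  The allowances for travel grow geometrically with \<open>k\<close>, so their sum is at most four times the last
  one, and minimality of \<open>S\<close> bounds the latter: \<open>13 / 4 * 50 * 4 * 16 / 3 = 10400 / 3 < 3500\<close>.
\<close>

lemma query_budget:
  assumes \<epsilon>: "\<epsilon> > 0" and \<mu>: "3 / 10 * \<mu>star \<le> \<mu>"
    and S: "S \<ge> 1 \<Longrightarrow> (4 / 3) ^ S < 4 / 3 * (4 * estimate_product 0 / (\<mu>star * \<epsilon>))"
  shows "budget 0 S \<mu> \<le> 3500 * M\<^sup>2 / (\<mu>star * \<epsilon>) + 6 * real S + 2 * log 2 (4 * \<mu>0 / \<mu>star) + 1"
proof -
  define p where "p = estimate_product 0"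
  have p0: "p \<ge> 0" by (simp add: p_def estimate_product_nonneg)
  have geom: "(\<Sum>j\<in>{1..n}. (4 / 3 :: real) ^ j) \<le> 4 * (4 / 3) ^ n" for n
    by (induction n) auto
  have scaled: "50 * M\<^sup>2 / estimate_product j = 50 * M\<^sup>2 / p * (4 / 3) ^ j" for j
    by (simp add: estimate_product_def p_def power_divide mult_ac)
  have "(\<Sum>j\<in>{1..S}. 13 / 4 * (50 * M\<^sup>2 / estimate_product j)) \<le> 3500 * M\<^sup>2 / (\<mu>star * \<epsilon>)"
  proof (cases "S \<ge> 1")
    case True
    have pw: "(4 / 3) ^ S < 16 / 3 * (p / (\<mu>star * \<epsilon>))" using S[OF True] by (simp add: p_def)
    have "0 < (4 / 3 :: real) ^ S" by simp
    then have "0 < p / (\<mu>star * \<epsilon>)" using pw by linarith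
    then have p: "p > 0" using p0 \<mu>star_pos \<epsilon> by (simp add: zero_less_divide_iff)
    have "(\<Sum>j\<in>{1..S}. 13 / 4 * (50 * M\<^sup>2 / estimate_product j))
        = 13 / 4 * (50 * M\<^sup>2 / p) * (\<Sum>j\<in>{1..S}. (4 / 3) ^ j)"
      by (simp only: scaled sum_distrib_left mult.assoc)
    also have "\<dots> \<le> 13 / 4 * (50 * M\<^sup>2 / p) * (4 * (16 / 3 * (p / (\<mu>star * \<epsilon>))))"
      using geom[of S] pw p by (intro mult_left_mono) auto
    also have "\<dots> = 10400 / 3 * (M\<^sup>2 / (\<mu>star * \<epsilon>))" using p by simp
    also have "\<dots> \<le> 3500 * (M\<^sup>2 / (\<mu>star * \<epsilon>))"
      using \<mu>star_pos \<epsilon> by (intro mult_right_mono) auto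
    finally show ?thesis by simp
  qed (use \<mu>star_pos \<epsilon> in simp)
  then show ?thesis
    using log_modulus_le[OF \<mu>] by (simp add: budget_def sum.distrib)
qed

lemma run_inv_run:
  assumes "blw_run X f f' xinit \<mu>0 m \<sigma> N" "c \<ge> 0"
  shows "run_inv c (real (N n) + c * real n) (\<sigma> n)"
  using assms prefix_inv[of n \<sigma> N n c] by (simp add: blw_run_def)

lemma run_steps:
  assumes "blw_run X f f' xinit \<mu>0 m \<sigma> N"
  shows "\<exists>q. blw_step X f f' m (\<sigma> n) q (\<sigma> (Suc n))"
  using assms unfolding blw_run_def blw_prefix_def by blast

text \<open>
  With \<open>c = 1\<close> the cost includes the number of steps, so the cost bound limits the length of each outer
  iteration.
\<close>

lemma every_outer_reached:
  assumes run: "blw_run X f f' xinit \<mu>0 m \<sigma> N"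
  shows "\<exists>n. is_outer (\<sigma> n) \<and> outer_index (\<sigma> n) = k"
proof (rule outer_reached[where \<sigma> = \<sigma>, OF run_steps[OF run]])
  show "is_outer (\<sigma> 0)" "outer_index (\<sigma> 0) = 0"
    using run by (simp_all add: blw_run_def blw_prefix_def)
  fix n
  note cost = run_inv_cost[OF run_inv_run[OF run, of 1 n]]
  have "budget 1 (outer_index (\<sigma> n)) (modulus (\<sigma> n)) \<le> budget 1 (outer_index (\<sigma> n)) (\<mu>star / 4)"
    using log_modulus_le[of "modulus (\<sigma> n)"] cost(2) by (simp add: budget_def mult.commute)
  then show "real n \<le> budget 1 (outer_index (\<sigma> n)) (\<mu>star / 4) + 1"
    using cost(1) by simp
qed

lemma center_antimono:
  assumes run: "blw_run X f f' xinit \<mu>0 m \<sigma> N" and ij: "i \<le> j"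
  shows "infdist (center (\<sigma> j)) Xstar \<le> infdist (center (\<sigma> i)) Xstar"
proof (rule lift_Suc_antimono_le[OF _ ij])
  fix n
  show "infdist (center (\<sigma> (Suc n))) Xstar \<le> infdist (center (\<sigma> n)) Xstar"
    using center_step[OF run_inv_run[OF run, of 0 n]] run_steps[OF run, of n] by auto
qed

lemma outer_gap:
  assumes inv: "run_inv c C (Outer k x \<mu> \<Delta>)" and \<epsilon>: "\<epsilon> > 0"
    and k: "4 * estimate_product 0 / (\<mu>star * \<epsilon>) \<le> (4 / 3) ^ k"
  shows "f x - fstar \<le> \<epsilon>"
proof -
  have e: "estimates k x \<mu> \<Delta>" and gap: "f x - fstar \<le> max 1 (\<mu> / \<mu>star) * \<Delta>"
    using inv by (auto simp: run_inv_def)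
  \<comment> \<open>The factor is the inverse of the lower bound \<open>3 / 10\<close> on \<open>\<mu> / \<mu>star\<close>.\<close>
  have "max 1 (\<mu> / \<mu>star) * \<Delta> \<le> 10 / 3 * (\<mu> / \<mu>star) * \<Delta>"
    using e estimates_pos[OF e] \<mu>star_pos
    by (intro mult_right_mono) (auto simp: estimates_def field_simps)
  also have "\<dots> = 10 / 3 * (\<mu> * \<Delta> / \<mu>star)" by simp
  also have "\<mu> * \<Delta> = estimate_product 0 * (3 / 4) ^ k"
    using e by (simp add: estimates_def estimate_product_def)
  also have "10 / 3 * (estimate_product 0 * (3 / 4) ^ k / \<mu>star)
      \<le> 4 * (estimate_product 0 * (3 / 4) ^ k / \<mu>star)"
    using estimate_product_nonneg \<mu>star_pos by (intro mult_right_mono) auto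
  also have "\<dots> \<le> \<epsilon>"
    using k \<mu>star_pos \<epsilon> by (simp add: field_simps power_divide)
  finally show ?thesis using gap by linarith
qed

end

theorem theorem3p5:
  fixes X :: "'a::euclidean_space set"
    and f :: "'a \<Rightarrow> real" and f' :: "'a \<Rightarrow> 'a"
    and x0 :: 'a and M \<mu>star \<mu>0 \<Delta>0 \<epsilon> fstar :: real and Xstar :: "'a set" and m S :: nat
  assumes X: "closed X" "convex X"
    and f: "convex_on X f" "closed (epigraph X f)"
    and fstar: "fstar = (INF x\<in>X. f x)"
    and Xstar: "Xstar = minimizers X f" "Xstar \<noteq> {}"
    and subgrad: "\<forall>y\<in>X. f' y \<in> subdifferential X f y"
    and x0: "x0 \<in> X"
    and M: "M > 0"
      "\<forall>x\<in>X. \<forall>y\<in>X. 0 \<le> f x - lin f f' y x \<and> f x - lin f f' y x \<le> M * norm (x - y)"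
    and growth: "\<mu>star > 0"
      "\<forall>x\<in>{z\<in>X. f z \<le> f x0}. f x - fstar \<ge> \<mu>star / 2 * (infdist x Xstar)\<^sup>2"
    and m: "m \<ge> 1"
    and \<mu>0: "\<mu>0 \<ge> \<mu>star"
    and \<Delta>0: "\<Delta>0 = 2 * (norm (f' x0))\<^sup>2 / \<mu>0"
    and \<epsilon>: "\<epsilon> > 0"
    and S: "int S = max 0 \<lceil>log (4/3) (4 * \<mu>0 * \<Delta>0 / (\<mu>star * \<epsilon>))\<rceil>"
  shows
    "int S \<le> max 0 \<lceil>log (4/3) (8 * (norm (f' x0))\<^sup>2 / (\<mu>star * \<epsilon>))\<rceil>
     \<and> (\<forall>L \<sigma> N. blw_prefix X f f' x0 \<mu>0 m L \<sigma> N
          \<longrightarrow> (\<exists>q s. blw_step X f f' m (\<sigma> L) q s))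
     \<and> (\<forall>\<sigma> N. blw_run X f f' x0 \<mu>0 m \<sigma> N
          \<longrightarrow> (\<exists>\<tau> xbar \<mu> \<Delta>.
                (\<forall>k. \<sigma> (\<tau> k) = Outer k (xbar k) (\<mu> k) (\<Delta> k))
              \<and> f (xbar S) - fstar \<le> \<epsilon>
              \<and> (\<forall>k\<ge>1. infdist (xbar k) Xstar \<le> infdist (xbar (k - 1)) Xstar)
              \<and> real (N (\<tau> S)) \<le> 3500 * M\<^sup>2 / (\<mu>star * \<epsilon>) + 6 * real S
                                  + 2 * log 2 (4 * \<mu>0 / \<mu>star) + 1))"
proof -
  have arg_min: "z \<in> X \<and> (\<forall>x\<in>X. f z \<le> f x)" if "z \<in> Xstar" for z
    using that unfolding Xstar(1) minimizers_def is_arg_min_linorder by blast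
  have minimal: "z \<in> X \<and> f z = fstar" if "z \<in> Xstar" for z
    unfolding fstar using arg_min[OF that] by (intro conjI cInf_eq_minimum[symmetric]) auto
  have fstar_le: "fstar \<le> f x" if "x \<in> X" for x
    using Xstar(2) arg_min minimal that by fastforce
  have pos: "\<mu>star > 0" "\<mu>0 > 0" using growth(1) \<mu>0 by auto
  interpret blw_problem X f f' M \<mu>star fstar \<mu>0 Xstar x0 m
    by unfold_locales (use X f M x0 growth m \<mu>0 fstar_le minimal Xstar(2) in auto)
  have product: "4 * \<mu>0 * \<Delta>0 = 4 * estimate_product 0" "4 * \<mu>0 * \<Delta>0 = 8 * (norm (f' x0))\<^sup>2"
    using pos by (auto simp: \<Delta>0 estimate_product_def)
  have "0 \<le> 4 * estimate_product 0 / (\<mu>star * \<epsilon>)"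
    using estimate_product_nonneg pos \<epsilon> by simp
  note Sbounds = log_ceiling_bounds[OF _ this S[unfolded product(1)], simplified]
  have "\<exists>\<tau> xbar \<mu> \<Delta>.
                (\<forall>k. \<sigma> (\<tau> k) = Outer k (xbar k) (\<mu> k) (\<Delta> k))
              \<and> f (xbar S) - fstar \<le> \<epsilon>
              \<and> (\<forall>k\<ge>1. infdist (xbar k) Xstar \<le> infdist (xbar (k - 1)) Xstar)
              \<and> real (N (\<tau> S)) \<le> 3500 * M\<^sup>2 / (\<mu>star * \<epsilon>) + 6 * real S
                                  + 2 * log 2 (4 * \<mu>0 / \<mu>star) + 1"
    if run: "blw_run X f f' x0 \<mu>0 m \<sigma> N" for \<sigma> N
  proof -
    have "\<exists>n x \<mu> \<Delta>. \<sigma> n = Outer k x \<mu> \<Delta>" for k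
    proof -
      obtain n where "is_outer (\<sigma> n)" "outer_index (\<sigma> n) = k"
        using every_outer_reached[OF run] by blast
      then show ?thesis by (cases "\<sigma> n") auto
    qed
    then obtain \<tau> xbar \<mu> \<Delta> where \<tau>: "\<And>k. \<sigma> (\<tau> k) = Outer k (xbar k) (\<mu> k) (\<Delta> k)" by metis
    have inv: "run_inv 0 (real (N (\<tau> k))) (Outer k (xbar k) (\<mu> k) (\<Delta> k))" for k
      using run_inv_run[OF run, of 0 "\<tau> k"] \<tau>[of k] by simp
    have "f (xbar S) - fstar \<le> \<epsilon>"
      by (rule outer_gap[OF inv \<epsilon>]) (use Sbounds(1) in simp)
    moreover have "infdist (xbar k) Xstar \<le> infdist (xbar (k - 1)) Xstar" if "k \<ge> 1" for k
    proof -
      have "\<tau> (k - 1) \<le> \<tau> k"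
      proof (rule ccontr)
        assume "\<not> ?thesis"
        then have "outer_index (\<sigma> (\<tau> k)) \<le> outer_index (\<sigma> (\<tau> (k - 1)))"
          by (intro outer_index_mono[where \<sigma> = \<sigma>, OF run_steps[OF run]]) simp
        then show False using \<tau> \<open>k \<ge> 1\<close> by simp
      qed
      then show ?thesis using center_antimono[OF run] \<tau> by (metis center.simps(1))
    qed
    moreover have "real (N (\<tau> S)) \<le> 3500 * M\<^sup>2 / (\<mu>star * \<epsilon>) + 6 * real S
                                  + 2 * log 2 (4 * \<mu>0 / \<mu>star) + 1"
    proof -
      have "real (N (\<tau> S)) \<le> budget 0 S (\<mu> S)" "3 / 10 * \<mu>star \<le> \<mu> S"
        using inv[of S] by (auto simp: run_inv_def estimates_def)
      then show ?thesis using query_budget[OF \<epsilon>, of "\<mu> S" S] Sbounds(2) by simp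
    qed
    ultimately show ?thesis using \<tau> by blast
  qed
  moreover have "\<exists>q s. blw_step X f f' m (\<sigma> L) q s" if "blw_prefix X f f' x0 \<mu>0 m L \<sigma> N" for L \<sigma> N
    using run_progress prefix_inv[OF that, of L 0] by blast
  moreover have "int S \<le> max 0 \<lceil>log (4/3) (8 * (norm (f' x0))\<^sup>2 / (\<mu>star * \<epsilon>))\<rceil>"
    using S unfolding product(2) by simp
  ultimately show ?thesis by blast
qed

end
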